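(* The class $\mathcal{A}=\mathcal{A}^3_{\infty,0,7,10}$ satisfies both an unlabeled and a labeled 0--1 law: for every first-order sentence $\phi$ in the language $\mathcal{L}=\{R_1,R_2,R_3\}$, the limit $\lim_{n\to\infty}\mathfrak{m}_{\mathcal{A},\phi}(n)$ exists and lies in $\{0,1\}$, both when $\mathfrak{m}_{\mathcal{A},\phi}(n)$ is the proportion of isomorphism classes of $n$-point members of $\mathcal{A}$ satisfying $\phi$ (unlabeled) and when it is the proportion of members of $\mathcal{A}$ with universe $\{1,\dots,n\}$ satisfying $\phi$ (labeled). Moreover, the almost sure theory of $\mathcal{A}^3_{\infty,0,7,10}$ (the set of sentences $\phi$ whose limit is $1$) coincides with the generic theory, i.e. with the complete first-order theory of $\Gamma^3_{\infty,0,7,10}$.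
   Context: All metric spaces considered have all distances between distinct points in $\{1,2,3\}$; they are viewed as $\mathcal{L}$-structures with $\mathcal{L}=\{R_1,R_2,R_3\}$, where $R_i(x,y)$ means $d(x,y)=i$, and isomorphism means isometry. For three distinct points, the triangle they form is the multiset of their three pairwise distances. $\mathcal{A}^3_{\infty,0,7,10}$ is the class of finite metric spaces with distances in $\{1,2,3\}$ in which every triangle is one of $\{1,1,2\}$, $\{1,2,3\}$, $\{2,2,2\}$, $\{2,3,3\}$ (equivalently: containing no triangle of odd perimeter, none of perimeter at least $10$, and none of the form $(1,k,k)$). This class is a Fraïssé (amalgamation) class, and $\Gamma^3_{\infty,0,7,10}$ denotes its Fraïssé limit, the countable homogeneous metric space whose finite substructures are exactly the members of the class (the generic bipartite graph of diameter $3$ with its path metric). *)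

theory Defs
  imports "HOL-Analysis.Analysis" "HOL-Library.Multiset"
begin

section \<open>First-order logic over the language of three binary relations\<close>

datatype rel_sym = R1 | R2 | R3

datatype fo =
    Rel rel_sym nat nat
  | Eq nat nat
  | Falsum
  | Neg fo
  | Conj fo fo
  | Ex nat fo

primrec free_vars :: "fo \<Rightarrow> nat set" where
  "free_vars (Rel r x y) = {x, y}"
| "free_vars (Eq x y) = {x, y}"
| "free_vars Falsum = {}"
| "free_vars (Neg p) = free_vars p"
| "free_vars (Conj p q) = free_vars p \<union> free_vars q"
| "free_vars (Ex x p) = free_vars p - {x}"

definition sentence :: "fo \<Rightarrow> bool" where
  "sentence p \<longleftrightarrow> free_vars p = {}"

primrec sat :: "'a set \<Rightarrow> (rel_sym \<Rightarrow> 'a \<Rightarrow> 'a \<Rightarrow> bool) \<Rightarrow> (nat \<Rightarrow> 'a) \<Rightarrow> fo \<Rightarrow> bool" where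
  "sat M I v (Rel r x y) \<longleftrightarrow> I r (v x) (v y)"
| "sat M I v (Eq x y) \<longleftrightarrow> v x = v y"
| "sat M I v Falsum \<longleftrightarrow> False"
| "sat M I v (Neg p) \<longleftrightarrow> \<not> sat M I v p"
| "sat M I v (Conj p q) \<longleftrightarrow> sat M I v p \<and> sat M I v q"
| "sat M I v (Ex x p) \<longleftrightarrow> (\<exists>a\<in>M. sat M I (v(x := a)) p)"

primrec rel_dist :: "rel_sym \<Rightarrow> real" where
  "rel_dist R1 = 1"
| "rel_dist R2 = 2"
| "rel_dist R3 = 3"

definition metric_interp :: "('a \<Rightarrow> 'a \<Rightarrow> real) \<Rightarrow> rel_sym \<Rightarrow> 'a \<Rightarrow> 'a \<Rightarrow> bool" where
  "metric_interp d r x y \<longleftrightarrow> d x y = rel_dist r"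

text \<open>
  This is used for sentences only, whose truth value does not depend on the assignment.
  Assignments are not restricted to \<open>M\<close>, so that the empty space needs no special treatment.
\<close>

definition models :: "'a set \<Rightarrow> ('a \<Rightarrow> 'a \<Rightarrow> real) \<Rightarrow> fo \<Rightarrow> bool" where
  "models M d p \<longleftrightarrow> (\<forall>v. sat M (metric_interp d) v p)"

definition theory_of :: "'a set \<Rightarrow> ('a \<Rightarrow> 'a \<Rightarrow> real) \<Rightarrow> fo set" where
  "theory_of M d = {p. sentence p \<and> models M d p}"


section \<open>The class of metric spaces and its Fraisse limit\<close>

definition isometry_between ::
  "'a set \<Rightarrow> ('a \<Rightarrow> 'a \<Rightarrow> real) \<Rightarrow> 'b set \<Rightarrow> ('b \<Rightarrow> 'b \<Rightarrow> real) \<Rightarrow> ('a \<Rightarrow> 'b) \<Rightarrow> bool" where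
  "isometry_between X d Y e f \<longleftrightarrow>
     bij_betw f X Y \<and> (\<forall>x\<in>X. \<forall>y\<in>X. e (f x) (f y) = d x y)"

definition isometric ::
  "'a set \<Rightarrow> ('a \<Rightarrow> 'a \<Rightarrow> real) \<Rightarrow> 'b set \<Rightarrow> ('b \<Rightarrow> 'b \<Rightarrow> real) \<Rightarrow> bool" where
  "isometric X d Y e \<longleftrightarrow> (\<exists>f. isometry_between X d Y e f)"

definition triangle_of :: "('a \<Rightarrow> 'a \<Rightarrow> real) \<Rightarrow> 'a \<Rightarrow> 'a \<Rightarrow> 'a \<Rightarrow> real multiset" where
  "triangle_of d x y z = {# d x y, d y z, d x z #}"

definition in_class :: "'a set \<Rightarrow> ('a \<Rightarrow> 'a \<Rightarrow> real) \<Rightarrow> bool" where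
  "in_class M d \<longleftrightarrow>
     finite M \<and> Metric_space M d \<and>
     (\<forall>x\<in>M. \<forall>y\<in>M. x \<noteq> y \<longrightarrow> d x y \<in> {1, 2, 3}) \<and>
     (\<forall>x\<in>M. \<forall>y\<in>M. \<forall>z\<in>M. x \<noteq> y \<and> y \<noteq> z \<and> x \<noteq> z \<longrightarrow>
        triangle_of d x y z \<in> {{# 1, 1, 2 #}, {# 1, 2, 3 #}, {# 2, 2, 2 #}, {# 2, 3, 3 #}})"

definition homogeneous :: "'a set \<Rightarrow> ('a \<Rightarrow> 'a \<Rightarrow> real) \<Rightarrow> bool" where
  "homogeneous M d \<longleftrightarrow>
     (\<forall>X Y f. finite X \<and> X \<subseteq> M \<and> Y \<subseteq> M \<and> isometry_between X d Y d f \<longrightarrow>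
        (\<exists>g. isometry_between M d M d g \<and> (\<forall>x\<in>X. g x = f x)))"

text \<open>
  The finite subspaces are, up to isometry, exactly the members of the class. Every finite
  space is isometric to one on a set of natural numbers, so it suffices to embed those.
\<close>

definition fraisse_limit :: "'a set \<Rightarrow> ('a \<Rightarrow> 'a \<Rightarrow> real) \<Rightarrow> bool" where
  "fraisse_limit M d \<longleftrightarrow>
     Metric_space M d \<and> countable M \<and> homogeneous M d \<and>
     (\<forall>X. finite X \<and> X \<subseteq> M \<longrightarrow> in_class X d) \<and>
     (\<forall>(N :: nat set) e. in_class N e \<longrightarrow> (\<exists>X \<subseteq> M. isometric N e X d))"


section \<open>Labeled and unlabeled proportions\<close>

text \<open>
  A metric is a total function, so its values off the universe are fixed to be 0; distinct
  elements of the following set are then distinct structures.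
\<close>

definition labeled_members :: "nat \<Rightarrow> (nat \<Rightarrow> nat \<Rightarrow> real) set" where
  "labeled_members n =
     {d. in_class {1..n} d \<and> (\<forall>x y. x \<notin> {1..n} \<or> y \<notin> {1..n} \<longrightarrow> d x y = 0)}"

definition isometry_rel :: "nat \<Rightarrow> ((nat \<Rightarrow> nat \<Rightarrow> real) \<times> (nat \<Rightarrow> nat \<Rightarrow> real)) set" where
  "isometry_rel n =
     {(d, e). d \<in> labeled_members n \<and> e \<in> labeled_members n \<and> isometric {1..n} d {1..n} e}"

text \<open>
  Every n-point space is isometric to one with universe \<open>{1..n}\<close>, so the isomorphism
  classes of n-point members correspond to the following equivalence classes.
\<close>

definition unlabeled_members :: "nat \<Rightarrow> (nat \<Rightarrow> nat \<Rightarrow> real) set set" where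
  "unlabeled_members n = labeled_members n // isometry_rel n"

definition labeled_proportion :: "fo \<Rightarrow> nat \<Rightarrow> real" where
  "labeled_proportion p n =
     real (card {d \<in> labeled_members n. models {1..n} d p}) / real (card (labeled_members n))"

definition unlabeled_proportion :: "fo \<Rightarrow> nat \<Rightarrow> real" where
  "unlabeled_proportion p n =
     real (card {C \<in> unlabeled_members n. \<forall>d\<in>C. models {1..n} d p})
       / real (card (unlabeled_members n))"

definition zero_one_law :: "(fo \<Rightarrow> nat \<Rightarrow> real) \<Rightarrow> bool" where
  "zero_one_law m \<longleftrightarrow> (\<forall>p. sentence p \<longrightarrow> (\<exists>l\<in>{0, 1}. m p \<longlonglongrightarrow> l))"

definition almost_sure_theory :: "(fo \<Rightarrow> nat \<Rightarrow> real) \<Rightarrow> fo set" where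
  "almost_sure_theory m = {p. sentence p \<and> m p \<longlonglongrightarrow> 1}"

end

theory Submission
  imports Defs "HOL-Library.Nat_Bijection" "HOL-Combinatorics.Permutations"
    "HOL-Real_Asymp.Real_Asymp"
begin

text \<open>
  The allowed triangles are exactly those of even perimeter, so being at distance 0 or 2 is an
  equivalence relation with at most two classes, and a member of the class is an unordered
  bipartition together with an arbitrary bipartite graph (distance 1 = edge, distance 3 = non-edge).
  By back and forth, a sentence with \<open>k\<close> variables has the same truth value in all such spaces with
  the one-point extension property over sets of size \<open>k\<close>; the Fraisse limit has this property for
  every \<open>k\<close>. A random labeled member has parts of size at least \<open>n/8\<close> and then satisfies the
  extension property, up to an exponentially small proportion. For the unlabeled law, \<open>n!\<close> times the
  number of isometry classes meeting an invariant set is at most the number of pairs of a structure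
  in that set and an automorphism of it. A permutation moving \<open>s\<close> points moves about \<open>s n\<close> cross
  pairs, so only a fraction of about \<open>2 ^ (- c s n)\<close> of the structures admit it, which outweighs the
  at most \<open>n ^ (2 s)\<close> choices of the permutation.
\<close>

section \<open>Bipartite spaces and one-point extensions\<close>

text \<open>One quantity drives both laws: the sum of the sizes of the automorphism groups over the
  structures that fail the extension property, divided by the number of labeled structures. Every
  group contains the identity, so this bounds the labeled proportion of failures. It also bounds the
  unlabeled one, because an isometry class has at most n! members and so there are at least (labeled
  count) / n! classes.

  The obstacle is the unbalanced bipartitions: with a small part there are few cross pairs, and the
  estimate on moved cross pairs says little. They are discarded by size alone. A part smaller than
  \<open>n div 8\<close> leaves at most n^2 / 8 cross pairs, a balanced bipartition has about n^2 /
  4, and the factors 2 ^ n for the bipartitions and n ^ n for the permutations do not close that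
  gap. Any threshold c n with 0 < c < 1/4 would serve.

  The truth value to which the proportions converge is read off in a Fraisse limit, so one has to be
  exhibited. This uses both directions of the fact that countable Fraisse limits are characterized
  by the extension property.\<close>

text \<open>Finiteness is left out so that the limit qualifies. Nonnegativity and symmetry range
  over all points because \<open>Metric_space\<close> demands them outside the carrier too.\<close>

definition bipartite_space :: "'a set \<Rightarrow> ('a \<Rightarrow> 'a \<Rightarrow> real) \<Rightarrow> bool" where
  "bipartite_space M d \<longleftrightarrow>
     (\<forall>x y. 0 \<le> d x y) \<and> (\<forall>x y. d x y = d y x) \<and> (\<forall>x\<in>M. d x x = 0) \<and>
     (\<forall>x\<in>M. \<forall>y\<in>M. x \<noteq> y \<longrightarrow> d x y \<in> {1, 2, 3}) \<and>
     (\<forall>x\<in>M. \<forall>y\<in>M. \<forall>z\<in>M. x \<noteq> y \<and> y \<noteq> z \<and> x \<noteq> z \<longrightarrow>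
        (d x y = 2) = ((d y z = 2) = (d x z = 2)))"

lemma bipartite_spaceD:
  assumes "bipartite_space M d"
  shows "0 \<le> d x y" "d x y = d y x" "x \<in> M \<Longrightarrow> d x x = 0"
    "x \<in> M \<Longrightarrow> y \<in> M \<Longrightarrow> x \<noteq> y \<Longrightarrow> d x y \<in> {1, 2, 3}"
    "x \<in> M \<Longrightarrow> y \<in> M \<Longrightarrow> z \<in> M \<Longrightarrow> x \<noteq> y \<Longrightarrow> y \<noteq> z \<Longrightarrow> x \<noteq> z \<Longrightarrow>
       (d x y = 2) = ((d y z = 2) = (d x z = 2))"
proof -
  note A = assms[unfolded bipartite_space_def]
  show "0 \<le> d x y" using A by simp
  show "d x y = d y x" by (rule A[THEN conjunct2, THEN conjunct1, rule_format])
  show "x \<in> M \<Longrightarrow> d x x = 0" by (rule A[THEN conjunct2, THEN conjunct2, THEN conjunct1, rule_format])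
  show "x \<in> M \<Longrightarrow> y \<in> M \<Longrightarrow> x \<noteq> y \<Longrightarrow> d x y \<in> {1, 2, 3}"
    by (rule A[THEN conjunct2, THEN conjunct2, THEN conjunct2, THEN conjunct1, rule_format])
  show "x \<in> M \<Longrightarrow> y \<in> M \<Longrightarrow> z \<in> M \<Longrightarrow> x \<noteq> y \<Longrightarrow> y \<noteq> z \<Longrightarrow> x \<noteq> z \<Longrightarrow>
       (d x y = 2) = ((d y z = 2) = (d x z = 2))"
    by (rule A[THEN conjunct2, THEN conjunct2, THEN conjunct2, THEN conjunct2, rule_format]) simp_all
qed

lemma bipartite_space_subset: "bipartite_space M d \<Longrightarrow> X \<subseteq> M \<Longrightarrow> bipartite_space X d"
  unfolding bipartite_space_def by (meson subsetD)

lemma bipartite_space_eq_iff: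
  "bipartite_space M d \<Longrightarrow> x \<in> M \<Longrightarrow> y \<in> M \<Longrightarrow> d x y = 0 \<longleftrightarrow> x = y"
  using bipartite_spaceD(3)[of M d x] bipartite_spaceD(4)[of M d x y] by fastforce

text \<open>The right-hand side is a parity condition: an odd number of the three distances equals
  2, that is, the perimeter is even. Being symmetric in \<open>a\<close>, \<open>b\<close>,
  \<open>c\<close>, it does not depend on how the triangle is listed.\<close>

lemma allowed_triangle_iff:
  fixes a b c :: real
  assumes "a \<in> {1, 2, 3}" "b \<in> {1, 2, 3}" "c \<in> {1, 2, 3}"
  shows "{# a, b, c #} \<in> {{# 1, 1, 2 #}, {# 1, 2, 3 #}, {# 2, 2, 2 #}, {# 2, 3, 3 #}} \<longleftrightarrow>
    (a = 2) = ((b = 2) = (c = 2))"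
  using assms by (elim insertE emptyE; simp add: add_eq_conv_diff)

lemma bipartite_space_imp_Metric_space:
  assumes "bipartite_space M d" shows "Metric_space M d"
proof
  note D = bipartite_spaceD[OF assms]
  show "0 \<le> d x y" "d x y = d y x" for x y using D by auto
  show "(d x y = 0) = (x = y)" if "x \<in> M" "y \<in> M" for x y
    using bipartite_space_eq_iff[OF assms that] .
  show "d x z \<le> d x y + d y z" if "x \<in> M" "y \<in> M" "z \<in> M" for x y z
  proof (cases "x = y \<or> y = z \<or> x = z")
    case True
    then show ?thesis using D(1,3) that by auto
  next
    case False
    then have "d x y \<in> {1,2,3}" "d y z \<in> {1,2,3}" "d x z \<in> {1,2,3}"
      "(d x y = 2) = ((d y z = 2) = (d x z = 2))"
      using D(4,5) that by blast+
    \<comment> \<open>The only values that could break the triangle inequality are 1, 1, 3, and they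
      contain no 2.\<close>
    then show ?thesis by auto
  qed
qed

lemma in_class_iff: "in_class M d \<longleftrightarrow> finite M \<and> bipartite_space M d"
proof
  assume c: "in_class M d"
  then interpret Metric_space M d by (simp add: in_class_def)
  have rng: "d x y \<in> {1,2,3}" if "x \<in> M" "y \<in> M" "x \<noteq> y" for x y
    using c that unfolding in_class_def by blast
  have "(d x y = 2) = ((d y z = 2) = (d x z = 2))"
    if "x \<in> M" "y \<in> M" "z \<in> M" "x \<noteq> y" "y \<noteq> z" "x \<noteq> z" for x y z
    using c that allowed_triangle_iff[OF rng rng rng, of x y y z x z]
    unfolding in_class_def triangle_of_def by blast
  then show "finite M \<and> bipartite_space M d"
    using c rng commute nonneg unfolding bipartite_space_def in_class_def by auto
next
  assume "finite M \<and> bipartite_space M d"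
  then have f: "finite M" and b: "bipartite_space M d" by auto
  note D = bipartite_spaceD[OF b]
  have "triangle_of d x y z \<in> {{# 1, 1, 2 #}, {# 1, 2, 3 #}, {# 2, 2, 2 #}, {# 2, 3, 3 #}}"
    if "x \<in> M" "y \<in> M" "z \<in> M" "x \<noteq> y" "y \<noteq> z" "x \<noteq> z" for x y z
    using allowed_triangle_iff[OF D(4) D(4) D(4), of x y y z x z] D(5) that
    unfolding triangle_of_def by blast
  then show "in_class M d"
    using f D(4) bipartite_space_imp_Metric_space[OF b] unfolding in_class_def by blast
qed

section \<open>Extension axioms, and back and forth for formulas with few variables\<close>

text \<open>The condition on \<open>f\<close> says precisely that a new point at distances
  \<open>f\<close> creates only allowed triangles with points of \<open>X\<close>. The case of empty
  \<open>X\<close> makes \<open>M\<close> nonempty.\<close>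

definition one_point_ext :: "nat \<Rightarrow> 'a set \<Rightarrow> ('a \<Rightarrow> 'a \<Rightarrow> real) \<Rightarrow> bool" where
  "one_point_ext k M d \<longleftrightarrow>
     (\<forall>X f. X \<subseteq> M \<and> finite X \<and> card X \<le> k \<and> (\<forall>x\<in>X. f x \<in> {1, 2, 3}) \<and>
        (\<forall>x\<in>X. \<forall>y\<in>X. x \<noteq> y \<longrightarrow> (d x y = 2) = ((f x = 2) = (f y = 2))) \<longrightarrow>
        (\<exists>z\<in>M - X. \<forall>x\<in>X. d z x = f x))"

text \<open>The partial isometry is given by two assignments on a set of variables, and several
  variables may name the same point. \<open>s\<close> picks one variable for each point in the image
  of \<open>w\<close>; the choice is immaterial because points at distance 0 coincide.\<close>

lemma extend_partial_isometry:
  fixes d :: "'a \<Rightarrow> 'a \<Rightarrow> real" and e :: "'b \<Rightarrow> 'b \<Rightarrow> real"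
  assumes M: "bipartite_space M d" and N: "bipartite_space N e" "one_point_ext k N e"
    and F: "finite F" "card F \<le> k" "v ` F \<subseteq> M" "w ` F \<subseteq> N"
    and iso: "\<And>i j. i \<in> F \<Longrightarrow> j \<in> F \<Longrightarrow> d (v i) (v j) = e (w i) (w j)"
    and a: "a \<in> M"
  obtains b where "b \<in> N" "\<And>i. i \<in> F \<Longrightarrow> e b (w i) = d a (v i)"
proof (cases "a \<in> v ` F")
  case True
  \<comment> \<open>The extension property yields only points outside the given set, so a value
    already taken is matched directly.\<close>
  then obtain i where "i \<in> F" "a = v i" by auto
  with that[of "w i"] iso F show ?thesis by auto
next
  case False
  define s where "s u = (SOME i. i \<in> F \<and> w i = u)" for u
  have s: "s u \<in> F \<and> w (s u) = u" if "u \<in> w ` F" for u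
    unfolding s_def by (rule someI_ex) (use that in auto)
  have vs: "v (s (w i)) = v i" if "i \<in> F" for i
  proof -
    have "d (v (s (w i))) (v i) = e (w i) (w i)" using s[of "w i"] that iso by auto
    also have "\<dots> = 0" using that F bipartite_spaceD(3)[OF N(1)] by auto
    finally show ?thesis using bipartite_space_eq_iff[OF M] s[of "w i"] that F by blast
  qed
  have "\<exists>z\<in>N - w ` F. \<forall>x\<in>w ` F. e z x = d a (v (s x))"
  proof (rule N(2)[unfolded one_point_ext_def, rule_format], intro conjI ballI impI)
    show "card (w ` F) \<le> k" using F card_image_le le_trans by blast
    show "d a (v (s x)) \<in> {1,2,3}" if "x \<in> w ` F" for x
      using bipartite_spaceD(4)[OF M a] s[OF that] F False by blast
    show "(e x y = 2) = ((d a (v (s x)) = 2) = (d a (v (s y)) = 2))"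
      if xy: "x \<in> w ` F" "y \<in> w ` F" "x \<noteq> y" for x y
    proof -
      have e: "e x y = d (v (s x)) (v (s y))" using s[OF xy(1)] s[OF xy(2)] iso by metis
      have "e x y \<noteq> 0" using bipartite_space_eq_iff[OF N(1)] xy F by blast
      then have "v (s x) \<noteq> v (s y)"
        using e bipartite_space_eq_iff[OF M] s xy F by (metis imageI subsetD)
      moreover have "v (s x) \<in> M" "v (s y) \<in> M" "a \<noteq> v (s x)" "a \<noteq> v (s y)"
        using s[OF xy(1)] s[OF xy(2)] F False by auto
      ultimately show ?thesis
        using bipartite_spaceD(5)[OF M a, of "v (s x)" "v (s y)"] e by auto
    qed
  qed (use F in auto)
  then show ?thesis using that vs by (metis Diff_iff imageI)
qed

lemma fun_upd_isometry:
  assumes "\<And>x y. d x y = d y x" "\<And>x y. e x y = e y x" "d a a = e b b"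
    and "\<And>i. i \<in> F \<Longrightarrow> i \<noteq> x \<Longrightarrow> e b (w i) = d a (v i)"
    and "\<And>i j. i \<in> F \<Longrightarrow> j \<in> F \<Longrightarrow> i \<noteq> x \<Longrightarrow> j \<noteq> x \<Longrightarrow> d (v i) (v j) = e (w i) (w j)"
    and "i \<in> F" "j \<in> F"
  shows "d ((v(x := a)) i) ((v(x := a)) j) = e ((w(x := b)) i) ((w(x := b)) j)"
  using assms(3-) assms(1)[of "v i" a] assms(2)[of "w i" b] by (cases "i = x"; cases "j = x") simp_all

text \<open>Bound variables are included: passing under a quantifier can enlarge the set of free
  variables, whereas this set only shrinks in subformulas, so a single \<open>k\<close> serves the
  whole induction.\<close>

primrec vars :: "fo \<Rightarrow> nat set" where
  "vars (Rel r x y) = {x, y}"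
| "vars (Eq x y) = {x, y}"
| "vars Falsum = {}"
| "vars (Neg p) = vars p"
| "vars (Conj p q) = vars p \<union> vars q"
| "vars (Ex x p) = insert x (vars p)"

lemma finite_vars: "finite (vars p)"
  by (induction p) auto

lemma free_vars_subset_vars: "free_vars p \<subseteq> vars p"
  by (induction p) auto

text \<open>The pebble game with one pebble per variable. The isometry is maintained on free
  variables only; requantifying a variable forgets its old value, so there are never more than
  \<open>k\<close> points to extend over.\<close>

lemma sat_cong_one_point_ext:
  fixes d :: "'a \<Rightarrow> 'a \<Rightarrow> real" and e :: "'b \<Rightarrow> 'b \<Rightarrow> real"
  assumes M: "bipartite_space M d" "one_point_ext k M d"
    and N: "bipartite_space N e" "one_point_ext k N e"
    and "card (vars p) \<le> k"
    and "\<And>i. i \<in> free_vars p \<Longrightarrow> v i \<in> M" "\<And>i. i \<in> free_vars p \<Longrightarrow> w i \<in> N"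
    and "\<And>i j. i \<in> free_vars p \<Longrightarrow> j \<in> free_vars p \<Longrightarrow> d (v i) (v j) = e (w i) (w j)"
  shows "sat M (metric_interp d) v p \<longleftrightarrow> sat N (metric_interp e) w p"
  using assms(5-)
proof (induction p arbitrary: v w)
  case (Eq x y)
  then have "d (v x) (v y) = e (w x) (w y)" "v x \<in> M" "v y \<in> M" "w x \<in> N" "w y \<in> N" by auto
  then show ?case
    using bipartite_space_eq_iff[OF M(1), of "v x" "v y"] bipartite_space_eq_iff[OF N(1), of "w x" "w y"] by simp
next
  case (Conj p q)
  have "card (vars p) \<le> k" "card (vars q) \<le> k"
    using Conj.prems(1) card_mono[of "vars p \<union> vars q"] finite_vars by force+
  then have "sat M (metric_interp d) v p \<longleftrightarrow> sat N (metric_interp e) w p"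
    "sat M (metric_interp d) v q \<longleftrightarrow> sat N (metric_interp e) w q"
    using Conj.prems(2-) by (intro Conj.IH; simp)+
  then show ?case by simp
next
  case (Ex x p)
  define F where "F = free_vars p - {x}"
  have F: "finite F" "card F \<le> k" "v ` F \<subseteq> M" "w ` F \<subseteq> N" "card (vars p) \<le> k"
  proof -
    have "F \<subseteq> vars (Ex x p)" unfolding F_def using free_vars_subset_vars[of p] by auto
    then show "finite F" "card F \<le> k"
      using Ex.prems(1) finite_vars finite_subset card_mono order_trans by metis+
    show "card (vars p) \<le> k"
      using Ex.prems(1) card_mono[OF finite_vars[of "Ex x p"], of "vars p"]
      by (simp add: subset_insertI)
  qed (use Ex.prems(2,3) in \<open>auto simp: F_def\<close>)
  have iso: "d (v i) (v j) = e (w i) (w j)" if "i \<in> F" "j \<in> F" for i j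
    using Ex.prems(4) that by (auto simp: F_def)
  have agree: "sat M (metric_interp d) (v(x := a)) p \<longleftrightarrow> sat N (metric_interp e) (w(x := b)) p"
    if ab: "a \<in> M" "b \<in> N" "\<And>i. i \<in> F \<Longrightarrow> e b (w i) = d a (v i)" for a b
  proof (rule Ex.IH)
    show "card (vars p) \<le> k" by fact
    show "(v(x := a)) i \<in> M" "(w(x := b)) i \<in> N" if "i \<in> free_vars p" for i
      using F that ab by (auto simp: F_def)
    show "d ((v(x := a)) i) ((v(x := a)) j) = e ((w(x := b)) i) ((w(x := b)) j)"
      if "i \<in> free_vars p" "j \<in> free_vars p" for i j
    proof (rule fun_upd_isometry[where d = d and e = e and F = "free_vars p", OF bipartite_spaceD(2)[OF M(1)] bipartite_spaceD(2)[OF N(1)]])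
      show "d a a = e b b"
        using ab bipartite_spaceD(3)[OF M(1)] bipartite_spaceD(3)[OF N(1)] by simp
    qed (use that ab(3) iso in \<open>auto simp: F_def\<close>)
  qed
  have "\<exists>b\<in>N. sat N (metric_interp e) (w(x := b)) p"
    if "a \<in> M" "sat M (metric_interp d) (v(x := a)) p" for a
    using extend_partial_isometry[OF M(1) N F(1-4) iso that(1)] agree that by metis
  moreover have "\<exists>a\<in>M. sat M (metric_interp d) (v(x := a)) p"
    if "b \<in> N" "sat N (metric_interp e) (w(x := b)) p" for b
    using extend_partial_isometry[OF N(1) M F(1,2,4,3) iso[symmetric] that(1)] agree that by metis
  ultimately show ?case by auto
qed (auto simp: metric_interp_def)

lemma models_iff_one_point_ext:
  assumes "bipartite_space M d" "one_point_ext k M d" "bipartite_space N e" "one_point_ext k N e"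
    and "sentence p" "card (vars p) \<le> k"
  shows "models M d p \<longleftrightarrow> models N e p"
proof -
  have "sat M (metric_interp d) v p \<longleftrightarrow> sat N (metric_interp e) w p" for v w
    using sat_cong_one_point_ext[OF assms(1-4,6)] assms(5) by (simp add: sentence_def)
  then show ?thesis unfolding models_def by blast
qed

text \<open>For a 2-colouring \<open>c\<close> of the points, an admissible \<open>f\<close> amounts
  to a choice of the side \<open>s\<close> for the new point plus free values 1 or 3 on the other
  side. This serves both the explicit limit and the random graphs.\<close>

lemma one_point_type_side:
  assumes "\<And>x y. x \<in> X \<Longrightarrow> y \<in> X \<Longrightarrow> x \<noteq> y \<Longrightarrow> (d x y = 2) = ((f x = 2) = (f y = (2::real)))"
    and "\<And>x y. x \<in> X \<Longrightarrow> y \<in> X \<Longrightarrow> x \<noteq> y \<Longrightarrow> d x y = (2::real) \<longleftrightarrow> (c x \<longleftrightarrow> c y)"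
  shows "\<exists>s. \<forall>x\<in>X. f x = 2 \<longleftrightarrow> (c x \<longleftrightarrow> s)"
proof (cases "X = {}")
  case False
  then obtain x0 where x0: "x0 \<in> X" by blast
  have "f x = 2 \<longleftrightarrow> (c x \<longleftrightarrow> (c x0 \<longleftrightarrow> f x0 = 2))" if "x \<in> X" for x
    using assms[OF x0 that] by (cases "x = x0") auto
  then show ?thesis by blast
qed simp

section \<open>The Fraisse limit\<close>

lemma bipartite_space_if_finite_subsets:
  assumes M: "Metric_space M d" and fin: "\<And>X. finite X \<Longrightarrow> X \<subseteq> M \<Longrightarrow> in_class X d"
  shows "bipartite_space M d"
proof -
  interpret Metric_space M d by fact
  have B: "bipartite_space {x, y, z} d" if "x \<in> M" "y \<in> M" "z \<in> M" for x y z
    using fin[of "{x, y, z}"] that by (auto simp: in_class_iff)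
  have "d x y \<in> {1, 2, 3}" if "x \<in> M" "y \<in> M" "x \<noteq> y" for x y
    by (rule bipartite_spaceD(4)[OF B[of x y y]]) (use that in auto)
  moreover have "(d x y = 2) = ((d y z = 2) = (d x z = 2))"
    if "x \<in> M" "y \<in> M" "z \<in> M" "x \<noteq> y" "y \<noteq> z" "x \<noteq> z" for x y z
    by (rule bipartite_spaceD(5)[OF B[of x y z]]) (use that in auto)
  ultimately show ?thesis
    using nonneg commute unfolding bipartite_space_def by simp
qed

lemma fraisse_limit_imp_bipartite_space:
  "fraisse_limit M d \<Longrightarrow> bipartite_space M d"
  unfolding fraisse_limit_def by (intro bipartite_space_if_finite_subsets) auto

text \<open>Adjoin the wanted point to a copy of \<open>X\<close>, embed the result in
  \<open>G\<close>, and use homogeneity to carry the embedded copy of \<open>X\<close> back onto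
  \<open>X\<close>. The adjoined point is carried along and becomes the witness.\<close>

lemma fraisse_limit_imp_one_point_ext:
  assumes G: "fraisse_limit G d"
  shows "one_point_ext k G d"
  unfolding one_point_ext_def
proof (intro allI impI, elim conjE)
  fix X and f :: "'a \<Rightarrow> real"
  assume X: "X \<subseteq> G" "finite X" and f: "\<forall>x\<in>X. f x \<in> {1, 2, 3}"
    "\<forall>x\<in>X. \<forall>y\<in>X. x \<noteq> y \<longrightarrow> (d x y = 2) = ((f x = 2) = (f y = 2))"
  note B = fraisse_limit_imp_bipartite_space[OF G]
  note D = bipartite_spaceD[OF B]
  define m where "m = card X"
  obtain h where h: "bij_betw h {..<m} X"
    using ex_bij_betw_nat_finite[OF X(2)] unfolding m_def by (auto simp: atLeast0LessThan)
  then have hX: "h i \<in> X" if "i < m" for i using that by (auto simp: bij_betw_def)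
  have hinj: "h i = h j \<longleftrightarrow> i = j" if "i < m" "j < m" for i j
    using h that by (auto simp: bij_betw_def inj_on_def)
  \<comment> \<open>The copy lives on numbers because \<open>fraisse_limit\<close> embeds only such
    spaces; \<open>m\<close> is the new point. The zeros beyond \<open>m\<close> keep
    \<open>e\<close> symmetric and nonnegative everywhere.\<close>
  define e where "e i j = (if i > m \<or> j > m \<or> i = j then 0 else if i = m then f (h j)
      else if j = m then f (h i) else d (h i) (h j))" for i j :: nat
  have fh: "f (h i) \<in> {1,2,3}" if "i < m" for i using f(1) hX that by blast
  have dh: "d (h i) (h j) \<in> {1,2,3}" if "i < m" "j < m" "i \<noteq> j" for i j
    using D(4) hX hinj X that by (meson subsetD)
  have tri_d: "(d (h i) (h j) = 2) = ((d (h j) (h l) = 2) = (d (h i) (h l) = 2))"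
    if "i < m" "j < m" "l < m" "i \<noteq> j" "j \<noteq> l" "i \<noteq> l" for i j l
    by (rule D(5)) (use that hX hinj X in auto)
  have tri_f: "(d (h i) (h j) = 2) = ((f (h i) = 2) = (f (h j) = 2))"
    if "i < m" "j < m" "i \<noteq> j" for i j
    using f(2) hX hinj that by blast
  have rng: "e i j \<in> {1,2,3}" if "i \<le> m" "j \<le> m" "i \<noteq> j" for i j
    using that fh[of i] fh[of j] dh[of i j] unfolding e_def by (cases "i = m"; cases "j = m") simp_all
  have "bipartite_space {..m} e"
    unfolding bipartite_space_def
  proof (intro conjI allI ballI impI)
    show "e i j = e j i" for i j
      using D(2)[of "h i" "h j"] unfolding e_def by simp
    show "0 \<le> e i j" for i j
      using rng[of i j] by (cases "i \<le> m \<and> j \<le> m \<and> i \<noteq> j") (auto simp: e_def)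
    show "e i i = 0" for i by (simp add: e_def)
    show "e i j \<in> {1,2,3}" if "i \<in> {..m}" "j \<in> {..m}" "i \<noteq> j" for i j
      using rng that by simp
    show "(e i j = 2) = ((e j l = 2) = (e i l = 2))"
      if ijl: "i \<in> {..m}" "j \<in> {..m}" "l \<in> {..m}" and ne: "i \<noteq> j \<and> j \<noteq> l \<and> i \<noteq> l" for i j l
    proof -
      consider "i < m" "j < m" "l < m" | "i = m" "j < m" "l < m" | "i < m" "j = m" "l < m"
        | "i < m" "j < m" "l = m"
        using ijl ne by force
      then show ?thesis
        using ne tri_d[of i j l] tri_f[of i j] tri_f[of j l] tri_f[of i l]
        unfolding e_def by cases auto
    qed
  qed
  then obtain Y where Y: "Y \<subseteq> G" "isometric {..m} e Y d"
    using G unfolding fraisse_limit_def in_class_iff by blast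
  then obtain g where g: "bij_betw g {..m} Y" "\<And>i j. i \<le> m \<Longrightarrow> j \<le> m \<Longrightarrow> d (g i) (g j) = e i j"
    unfolding isometric_def isometry_between_def by auto
  define p where "p = h \<circ> inv_into {..<m} g"
  have ginj: "inj_on g {..<m}" using g(1) by (auto simp: bij_betw_def inj_on_def)
  have p: "p (g i) = h i" if "i < m" for i
    using that ginj by (simp add: p_def inv_into_f_f)
  have "isometry_between (g ` {..<m}) d X d p"
    unfolding isometry_between_def
  proof
    show "bij_betw p (g ` {..<m}) X"
      unfolding p_def by (rule bij_betw_trans[OF bij_betw_inv_into h]) (simp add: bij_betw_def ginj)
    show "\<forall>x\<in>g ` {..<m}. \<forall>y\<in>g ` {..<m}. d (p x) (p y) = d x y"
    proof (clarsimp simp: p)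
      fix i j assume "i < m" "j < m"
      then show "d (h i) (h j) = d (g i) (g j)"
        using g(2)[of i j] D(3)[of "h j"] hX X unfolding e_def by auto
    qed
  qed
  moreover have "g ` {..<m} \<subseteq> G" using g(1) Y(1) by (auto simp: bij_betw_def)
  ultimately obtain a where a: "isometry_between G d G d a" "\<And>x. x \<in> g ` {..<m} \<Longrightarrow> a x = p x"
    using G X unfolding fraisse_limit_def homogeneous_def by (metis finite_imageI finite_lessThan)
  have gG: "g i \<in> G" if "i \<le> m" for i using g(1) Y(1) that by (auto simp: bij_betw_def)
  have "d (a (g m)) x = f x" if xX: "x \<in> X" for x
  proof -
    obtain i where i: "i < m" "x = h i" using h xX by (auto simp: bij_betw_def)
    then have "x = a (g i)" using a(2) p by simp
    then have "d (a (g m)) x = d (g m) (g i)"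
      using a(1) gG i unfolding isometry_between_def by simp
    then show ?thesis using g(2)[of m i] i by (simp add: e_def)
  qed
  moreover have "a (g m) \<in> G" using a(1) gG unfolding isometry_between_def bij_betw_def by auto
  moreover from this have "a (g m) \<notin> X" using calculation(1) f(1) D(3) by fastforce
  ultimately show "\<exists>z\<in>G - X. \<forall>x\<in>X. d z x = f x" by blast
qed

lemma one_point_ext_embeds_finite:
  assumes M: "bipartite_space M d" "\<And>k. one_point_ext k M d"
    and N: "finite N" "bipartite_space N e"
  shows "\<exists>w. w ` N \<subseteq> M \<and> (\<forall>i\<in>N. \<forall>j\<in>N. d (w i) (w j) = e i j)"
  using N
proof (induction N rule: finite_induct)
  case (insert a N)
  then obtain w where w: "w ` N \<subseteq> M" "\<forall>i\<in>N. \<forall>j\<in>N. d (w i) (w j) = e i j"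
    using bipartite_space_subset by blast
  obtain b where b: "b \<in> M" "\<And>i. i \<in> N \<Longrightarrow> d b (w i) = e a (id i)"
    using extend_partial_isometry[OF insert.prems M(1) M(2) insert.hyps(1) order_refl, of id w a] w
    by auto
  have "d ((w(a := b)) i) ((w(a := b)) j) = e i j" if "i \<in> insert a N" "j \<in> insert a N" for i j
  proof -
    have "d ((w(a := b)) i) ((w(a := b)) j) = e ((id(a := a)) i) ((id(a := a)) j)"
    proof (rule fun_upd_isometry[where d = d and e = e and F = "insert a N", OF bipartite_spaceD(2)[OF M(1)] bipartite_spaceD(2)[OF insert.prems]])
      show "d b b = e a a"
        using b(1) bipartite_spaceD(3)[OF M(1)] bipartite_spaceD(3)[OF insert.prems] by simp
    qed (use that b(2) w in auto)
    then show ?thesis by simp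
  qed
  then show ?case using b(1) w(1) insert.hyps(2) by (intro exI[of _ "w(a := b)"]) auto
qed simp

section \<open>Homogeneity by back and forth\<close>

text \<open>Relations are used instead of functions so that the back step is the forth step for the
  converse.\<close>

definition partial_isometry :: "'a set \<Rightarrow> ('a \<Rightarrow> 'a \<Rightarrow> real) \<Rightarrow> ('a \<times> 'a) set \<Rightarrow> bool" where
  "partial_isometry M d q \<longleftrightarrow> q \<subseteq> M \<times> M \<and>
     (\<forall>a b a' b'. (a, b) \<in> q \<and> (a', b') \<in> q \<longrightarrow> d a a' = d b b')"

lemma partial_isometryD:
  assumes "partial_isometry M d q"
  shows "q \<subseteq> M \<times> M" "(a, b) \<in> q \<Longrightarrow> (a', b') \<in> q \<Longrightarrow> d a a' = d b b'"
  using assms unfolding partial_isometry_def by simp_all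

lemma partial_isometry_converse:
  assumes "partial_isometry M d q" shows "partial_isometry M d (q\<inverse>)"
proof -
  have "d a a' = d b b'" if "(b, a) \<in> q" "(b', a') \<in> q" for a b a' b'
    using assms that unfolding partial_isometry_def by metis
  then show ?thesis using assms unfolding partial_isometry_def by auto
qed

lemma partial_isometry_forth:
  assumes M: "bipartite_space M d" "\<And>k. one_point_ext k M d"
    and q: "finite q" "partial_isometry M d q" and a: "a \<in> M"
  obtains b where "b \<in> M" "partial_isometry M d (insert (a, b) q)"
proof -
  have q': "fst ` q \<subseteq> M" "snd ` q \<subseteq> M"
    "d (fst s) (fst t) = d (snd s) (snd t)" if "s \<in> q" "t \<in> q" for s t
    using q(2) that unfolding partial_isometry_def
    by (auto simp: mem_Times_iff subset_iff)
  \<comment> \<open>The pairs in \<open>q\<close> themselves play the role of variables, with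
    \<open>fst\<close> and \<open>snd\<close> as the two assignments.\<close>
  obtain b where b: "b \<in> M" "\<And>t. t \<in> q \<Longrightarrow> d b (snd t) = d a (fst t)"
    using extend_partial_isometry[OF M(1) M(1) M(2) q(1) order_refl, of fst snd a] q' a
    by (metis all_not_in_conv)
  have "d x x' = d y y'" if "(x, y) \<in> insert (a, b) q" "(x', y') \<in> insert (a, b) q" for x y x' y'
  proof -
    have new: "d a x = d b y" if "(x, y) \<in> q" for x y using b(2)[OF that] by simp
    have "d a a = d b b" using b(1) a bipartite_spaceD(3)[OF M(1)] by simp
    moreover have "d x a = d y b" if "(x, y) \<in> q"
      using new[OF that] bipartite_spaceD(2)[OF M(1), of x a] bipartite_spaceD(2)[OF M(1), of y b] by simp
    moreover have "d x x' = d y y'" if "(x, y) \<in> q" "(x', y') \<in> q"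
      using q(2) that unfolding partial_isometry_def by blast
    ultimately show ?thesis using that new by auto
  qed
  moreover have "insert (a, b) q \<subseteq> M \<times> M" using b(1) a q(2) by (simp add: partial_isometry_def)
  ultimately have "partial_isometry M d (insert (a, b) q)" unfolding partial_isometry_def by simp
  then show ?thesis by (rule that[OF b(1)])
qed

lemma partial_isometry_back:
  assumes "bipartite_space M d" "\<And>k. one_point_ext k M d"
    and "finite q" "partial_isometry M d q" "b \<in> M"
  obtains a where "a \<in> M" "partial_isometry M d (insert (a, b) q)"
proof -
  obtain a where "a \<in> M" "partial_isometry M d (insert (b, a) (q\<inverse>))"
    by (rule partial_isometry_forth[OF assms(1,2), of "q\<inverse>" b])
      (use assms partial_isometry_converse in auto)
  moreover have "insert (b, a) (q\<inverse>) = (insert (a, b) q)\<inverse>" by auto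
  ultimately show ?thesis using that partial_isometry_converse by (metis converse_converse)
qed

text \<open>Along an enumeration of \<open>M\<close>, each stage puts the next point into both
  domain and range, so the union of the chain is defined everywhere and onto.\<close>

lemma partial_isometry_extends:
  assumes M: "bipartite_space M d" "\<And>k. one_point_ext k M d" "countable M"
    and q: "finite q" "partial_isometry M d q"
  obtains g where "isometry_between M d M d g" "\<And>a b. (a, b) \<in> q \<Longrightarrow> g a = b"
proof (cases "M = {}")
  case True
  then have "q = {}" using q by (simp add: partial_isometry_def)
  then show ?thesis using that[of id] True by (simp add: isometry_between_def)
next
  case False
  define en where "en = from_nat_into M"
  have en: "range en = M" using range_from_nat_into[OF False M(3)] by (simp add: en_def)
  define ok where "ok n r \<longleftrightarrow> finite r \<and> partial_isometry M d r \<and> q \<subseteq> r" for n :: nat and r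
  have step: "\<exists>r'. ok (Suc n) r' \<and> r \<subseteq> r' \<and> en n \<in> Domain r' \<and> en n \<in> Range r'" if "ok n r" for n r
  proof -
    have eM: "en n \<in> M" using en by auto
    have r: "finite r" "partial_isometry M d r" "q \<subseteq> r" using that by (auto simp: ok_def)
    obtain b where b: "partial_isometry M d (insert (en n, b) r)"
      using partial_isometry_forth[OF M(1,2) r(1,2) eM] by blast
    obtain a where a: "partial_isometry M d (insert (a, en n) (insert (en n, b) r))"
      using partial_isometry_back[OF M(1,2) _ b eM] r(1) by blast
    show ?thesis
      by (rule exI[of _ "insert (a, en n) (insert (en n, b) r)"]) (use a r in \<open>auto simp: ok_def\<close>)
  qed
  obtain r where r: "\<And>n. ok n (r n)"
    "\<And>n. r n \<subseteq> r (Suc n) \<and> en n \<in> Domain (r (Suc n)) \<and> en n \<in> Range (r (Suc n))"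
    using dependent_nat_choice[of ok "\<lambda>n r r'. r \<subseteq> r' \<and> en n \<in> Domain r' \<and> en n \<in> Range r'"]
      step q by (metis ok_def order_refl)
  have mono: "r m \<subseteq> r n" if "m \<le> n" for m n
    using r(2) that by (simp add: lift_Suc_mono_le)
  define R where "R = (\<Union>n. r n)"
  have iso: "d a a' = d b b'" if R: "(a, b) \<in> R" "(a', b') \<in> R" for a b a' b'
  proof -
    obtain m n where "(a, b) \<in> r m" "(a', b') \<in> r n" using R unfolding R_def by blast
    then have "(a, b) \<in> r (max m n)" "(a', b') \<in> r (max m n)"
      using mono[of m "max m n"] mono[of n "max m n"] by auto
    then show ?thesis using r(1)[of "max m n"] partial_isometryD(2) unfolding ok_def by metis
  qed
  have RM: "a \<in> M \<and> b \<in> M" if "(a, b) \<in> R" for a b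
    using that r(1) partial_isometryD(1) unfolding R_def ok_def by fast
  have dom: "\<exists>b. (a, b) \<in> R" and ran: "\<exists>b. (b, a) \<in> R" if "a \<in> M" for a
    using that r(2) en unfolding R_def by (metis Domain.cases UN_iff UNIV_I image_iff, metis Range.cases UN_iff UNIV_I image_iff)
  \<comment> \<open>Equality is distance 0 on both sides, so \<open>iso\<close> gives
    single-valuedness and injectivity at once.\<close>
  have uniq: "a = a' \<longleftrightarrow> b = b'" if "(a, b) \<in> R" "(a', b') \<in> R" for a b a' b'
    using iso[OF that] bipartite_space_eq_iff[OF M(1)] RM[OF that(1)] RM[OF that(2)] by metis
  define g where "g a = (SOME b. (a, b) \<in> R)" for a
  have g: "(a, g a) \<in> R" if "a \<in> M" for a unfolding g_def by (rule someI_ex) (rule dom[OF that])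
  have geq: "g a = b" if "(a, b) \<in> R" for a b
    using uniq[OF g that] RM[OF that] by blast
  have "bij_betw g M M"
    unfolding bij_betw_def
  proof
    show "inj_on g M" using g uniq by (metis inj_onI)
    show "g ` M = M"
    proof
      show "g ` M \<subseteq> M" using g RM by blast
      show "M \<subseteq> g ` M" using ran RM geq by (metis image_eqI subsetI)
    qed
  qed
  moreover have "d (g x) (g y) = d x y" if "x \<in> M" "y \<in> M" for x y
    using iso[OF g[OF that(1)] g[OF that(2)]] by simp
  ultimately have "isometry_between M d M d g" by (simp add: isometry_between_def)
  moreover have "g a = b" if "(a, b) \<in> q" for a b
  proof -
    have "(a, b) \<in> R" using that r(1) unfolding R_def ok_def by blast
    then show ?thesis by (rule geq)
  qed
  ultimately show ?thesis using that by blast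
qed

lemma fraisse_limit_if_one_point_ext:
  assumes M: "bipartite_space M d" "\<And>k. one_point_ext k M d" "countable M"
  shows "fraisse_limit M d"
  unfolding fraisse_limit_def homogeneous_def
proof (intro conjI allI impI; (elim conjE)?)
  show "Metric_space M d" by (rule bipartite_space_imp_Metric_space[OF M(1)])
  show "countable M" by fact
  show "in_class X d" if "finite X" "X \<subseteq> M" for X
    using that M(1) bipartite_space_subset by (auto simp: in_class_iff)
  show "\<exists>X\<subseteq>M. isometric N e X d" if "in_class N e" for N :: "nat set" and e
  proof -
    have N: "bipartite_space N e" "finite N" using that by (auto simp: in_class_iff)
    obtain w where w: "w ` N \<subseteq> M" "\<forall>i\<in>N. \<forall>j\<in>N. d (w i) (w j) = e i j"
      using one_point_ext_embeds_finite[OF M(1,2) N(2,1)] by blast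
    have "inj_on w N"
    proof (rule inj_onI)
      fix i j assume ij: "i \<in> N" "j \<in> N" "w i = w j"
      then have "e i j = d (w i) (w i)" using w(2) by metis
      also have "\<dots> = 0" using bipartite_spaceD(3)[OF M(1)] w(1) ij(1) by blast
      finally have "e i j = 0" .
      then show "i = j" using bipartite_space_eq_iff[OF N(1)] ij by blast
    qed
    then have "isometric N e (w ` N) d"
      using w(2) unfolding isometric_def isometry_between_def by (auto simp: bij_betw_def)
    then show ?thesis using w(1) by blast
  qed
  show "\<exists>g. isometry_between M d M d g \<and> (\<forall>x\<in>X. g x = f x)"
    if X: "finite X" "X \<subseteq> M" "Y \<subseteq> M" "isometry_between X d Y d f" for X Y f
  proof -
    have "partial_isometry M d ((\<lambda>x. (x, f x)) ` X)"
      using X unfolding partial_isometry_def isometry_between_def bij_betw_def by (auto 0 0 simp: image_subset_iff subset_iff)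
    then show ?thesis
      by (rule partial_isometry_extends[OF M finite_imageI[OF X(1)]]) blast
  qed
qed

text \<open>A bipartite variant of the Ackermann coding of the random graph: the colour of a number is its
  last binary digit, and \<open>x < y\<close> of different colours are adjacent iff digit \<open>x + 1\<close> of \<open>y\<close> is 1.\<close>

definition ack_dist :: "nat \<Rightarrow> nat \<Rightarrow> real" where
  "ack_dist x y = (if x = y then 0 else if even x = even y then 2
     else if Suc (min x y) \<in> set_decode (max x y) then 1 else 3)"

lemma bipartite_space_ack_dist: "bipartite_space UNIV ack_dist"
  unfolding bipartite_space_def ack_dist_def by (auto simp: max.commute min.commute)

lemma less_if_mem_set_decode: "n \<in> set_decode z \<Longrightarrow> n < z"
proof -
  assume "n \<in> set_decode z"
  then have "z div 2 ^ n \<noteq> 0" by (metis even_zero mem_Collect_eq set_decode_def)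
  then have "2 ^ n \<le> z" by (simp add: div_eq_0_iff)
  then show "n < z" using less_exp[of n] by linarith
qed

lemma one_point_ext_ack_dist: "one_point_ext k UNIV ack_dist"
  unfolding one_point_ext_def
proof (intro allI impI, elim conjE)
  fix X :: "nat set" and f :: "nat \<Rightarrow> real"
  assume X: "finite X" and f: "\<forall>x\<in>X. f x \<in> {1, 2, 3}"
    "\<forall>x\<in>X. \<forall>y\<in>X. x \<noteq> y \<longrightarrow> (ack_dist x y = 2) = ((f x = 2) = (f y = 2))"
  have "\<exists>s. \<forall>x\<in>X. f x = 2 \<longleftrightarrow> (even x \<longleftrightarrow> s)"
  proof (rule one_point_type_side)
    show "(ack_dist x y = 2) = ((f x = 2) = (f y = 2))" if "x \<in> X" "y \<in> X" "x \<noteq> y" for x y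
      using f(2) that by blast
    show "ack_dist x y = 2 \<longleftrightarrow> (even x \<longleftrightarrow> even y)" if "x \<noteq> y" for x y
      using that by (simp add: ack_dist_def)
  qed
  then obtain s where s: "\<forall>x\<in>X. f x = 2 \<longleftrightarrow> (even x \<longleftrightarrow> s)" by blast
  obtain b where b: "\<forall>x\<in>X. x < b" using X finite_nat_set_iff_bounded by blast
  \<comment> \<open>Digit 0 of \<open>z\<close> sets its colour, which is why neighbours are stored
    at digits \<open>Suc x\<close>. The digit \<open>Suc b\<close> belongs to no point of
    \<open>X\<close> and makes \<open>z\<close> larger than all of them, so that adjacency is read
    from the digits of \<open>z\<close>.\<close>
  define Z where "Z = insert (Suc b) (Suc ` {x\<in>X. f x = 1} \<union> (if s then {} else {0}))"
  define z where "z = set_encode Z"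
  have Z: "set_decode z = Z" unfolding z_def by (rule set_encode_inverse) (use X in \<open>simp add: Z_def\<close>)
  have "Suc b < z" by (rule less_if_mem_set_decode) (simp add: Z, simp add: Z_def)
  then have big: "x < z" if "x \<in> X" for x using b that by fastforce
  have "even z \<longleftrightarrow> 0 \<notin> set_decode z" by (simp add: set_decode_def)
  then have par: "even z \<longleftrightarrow> s" unfolding Z by (auto simp: Z_def)
  have "ack_dist z x = f x" if "x \<in> X" for x
  proof -
    have "Suc x \<in> Z \<longleftrightarrow> f x = 1" using b that by (auto simp: Z_def)
    moreover have "min z x = x" "max z x = z" "z \<noteq> x" using big[OF that] by auto
    moreover have "f x = 2 \<longleftrightarrow> even z = even x" using s that par by blast
    ultimately show ?thesis using f(1) that unfolding ack_dist_def by (auto simp: Z)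
  qed
  moreover have "z \<notin> X" using big by blast
  ultimately show "\<exists>z\<in>UNIV - X. \<forall>x\<in>X. ack_dist z x = f x" by blast
qed

lemma fraisse_limit_ack_dist: "fraisse_limit UNIV ack_dist"
  by (intro fraisse_limit_if_one_point_ext bipartite_space_ack_dist one_point_ext_ack_dist) simp

section \<open>Encoding by bipartite graphs\<close>

definition cross :: "'a set \<Rightarrow> 'a set \<Rightarrow> 'a set set" where
  "cross V A = (\<lambda>(a, b). {a, b}) ` (A \<times> (V - A))"

text \<open>The value 0 outside \<open>V\<close> matches the normalization in
  \<open>labeled_members\<close>.\<close>

definition graph_dist :: "'a set \<Rightarrow> 'a set \<Rightarrow> 'a set set \<Rightarrow> 'a \<Rightarrow> 'a \<Rightarrow> real" where
  "graph_dist V A E x y =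
     (if x \<notin> V \<or> y \<notin> V \<or> x = y then 0 else if x \<in> A \<longleftrightarrow> y \<in> A then 2
      else if {x, y} \<in> E then 1 else 3)"

lemma finite_cross: "finite V \<Longrightarrow> A \<subseteq> V \<Longrightarrow> finite (cross V A)"
  unfolding cross_def by (auto dest: finite_subset)

lemma card_cross: "card (cross V A) = card A * card (V - A)"
proof -
  have "inj_on (\<lambda>(a, b). {a, b}) (A \<times> (V - A))"
    by (auto simp: inj_on_def doubleton_eq_iff)
  then show ?thesis unfolding cross_def by (simp add: card_image card_cartesian_product)
qed

lemma crossI: "x \<in> V \<Longrightarrow> y \<in> V \<Longrightarrow> (x \<in> A) \<noteq> (y \<in> A) \<Longrightarrow> {x, y} \<in> cross V A"
  unfolding cross_def by (cases "x \<in> A") (auto simp: doubleton_eq_iff image_iff)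

lemma crossE:
  assumes "p \<in> cross V A" "A \<subseteq> V"
  obtains x y where "p = {x, y}" "x \<in> A" "y \<in> V - A"
  using assms unfolding cross_def by auto

lemma bipartite_space_graph_dist: "bipartite_space V (graph_dist V A E)"
  unfolding bipartite_space_def graph_dist_def by (auto simp: insert_commute)

lemma graph_dist_coloring:
  "x \<in> V \<Longrightarrow> y \<in> V \<Longrightarrow> x \<noteq> y \<Longrightarrow> graph_dist V A E x y = 2 \<longleftrightarrow> (x \<in> A \<longleftrightarrow> y \<in> A)"
  by (simp add: graph_dist_def)

lemma graph_dist_surj:
  assumes "bipartite_space V d" "\<And>x y. x \<notin> V \<or> y \<notin> V \<Longrightarrow> d x y = 0" "v \<in> V"
  shows "\<exists>A E. A \<subseteq> V \<and> v \<in> A \<and> E \<subseteq> cross V A \<and> graph_dist V A E = d"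
proof -
  note D = bipartite_spaceD[OF assms(1)]
  \<comment> \<open>The part containing \<open>v\<close> is its class for being at distance 0 or
    2.\<close>
  define A where "A = {x\<in>V. x = v \<or> d v x = 2}"
  define E where "E = {p \<in> cross V A. \<exists>x y. p = {x, y} \<and> d x y = 1}"
  have col: "d x y = 2 \<longleftrightarrow> (x \<in> A \<longleftrightarrow> y \<in> A)" if "x \<in> V" "y \<in> V" "x \<noteq> y" for x y
  proof -
    consider "x = v" | "y = v" | "x \<noteq> v" "y \<noteq> v" by blast
    then show ?thesis
    proof cases
      case 2
      then show ?thesis using that D(2)[of x y] by (simp add: A_def)
    next
      case 3
      then show ?thesis using that D(5)[OF assms(3), of x y] unfolding A_def by (simp only: mem_Collect_eq) blast
    qed (use that in \<open>simp add: A_def\<close>)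
  qed
  have edge: "{x, y} \<in> E \<longleftrightarrow> d x y = 1" if "{x, y} \<in> cross V A" for x y
  proof
    assume "{x, y} \<in> E"
    then obtain x' y' where "{x, y} = {x', y'}" "d x' y' = 1" by (auto simp: E_def)
    then show "d x y = 1" using D(2)[of x y] by (auto simp: doubleton_eq_iff)
  qed (use that in \<open>auto simp: E_def\<close>)
  have "graph_dist V A E x y = d x y" for x y
  proof (cases "x \<in> V \<and> y \<in> V \<and> x \<noteq> y")
    case True
    then show ?thesis
      using col[of x y] edge[OF crossI, of x y] D(4)[of x y]
      by (cases "x \<in> A \<longleftrightarrow> y \<in> A") (auto simp: graph_dist_def)
  next
    case False
    then show ?thesis using assms(2)[of x y] D(3)[of x] by (auto simp: graph_dist_def)
  qed
  then show ?thesis using assms(3)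
    by (intro exI[of _ A] exI[of _ E]) (auto simp: A_def E_def)
qed

lemma graph_dist_inj:
  assumes "A \<subseteq> V" "v \<in> A" "E \<subseteq> cross V A" "B \<subseteq> V" "v \<in> B" "F \<subseteq> cross V B"
    and eq: "graph_dist V A E = graph_dist V B F"
  shows "A = B \<and> E = F"
proof
  have "x \<in> A \<longleftrightarrow> x \<in> B" if "x \<in> V" "x \<noteq> v" for x
  proof -
    have "v \<in> V" using assms(1,2) by blast
    then have "graph_dist V A E v x = 2 \<longleftrightarrow> x \<in> A" "graph_dist V B F v x = 2 \<longleftrightarrow> x \<in> B"
      using graph_dist_coloring[of v V x] that assms(2,5) by metis+
    then show ?thesis using eq by simp
  qed
  then show AB: "A = B" using assms by blast
  have sub: "E1 \<subseteq> E2" if E12: "E1 \<subseteq> cross V A" "graph_dist V A E1 = graph_dist V A E2" for E1 E2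
  proof
    fix p assume p: "p \<in> E1"
    then obtain x y where xy: "p = {x, y}" "x \<in> A" "y \<in> V - A"
      using crossE[of p V A] E12(1) assms(1) by blast
    then have "graph_dist V A E1 x y = 1" using p assms(1) by (auto simp: graph_dist_def)
    then have "graph_dist V A E2 x y = 1" using E12(2) by simp
    then show "p \<in> E2" using xy by (auto simp: graph_dist_def split: if_splits)
  qed
  show "E = F" using sub[of E F] sub[of F E] eq assms AB by auto
qed

text \<open>A bipartition can be named by either of its parts; taking the one that contains 1 gives
  each labeled structure exactly one code.\<close>

definition codes :: "nat \<Rightarrow> (nat set \<times> nat set set) set" where
  "codes n = (SIGMA A:{A. A \<subseteq> {1..n} \<and> 1 \<in> A}. Pow (cross {1..n} A))"

lemma labeled_members_iff:
  "d \<in> labeled_members n \<longleftrightarrow> bipartite_space {1..n} d \<and>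
     (\<forall>x y. x \<notin> {1..n} \<or> y \<notin> {1..n} \<longrightarrow> d x y = 0)"
  unfolding labeled_members_def in_class_iff by auto

lemma bij_betw_labeled_members:
  assumes "n \<ge> 1"
  shows "bij_betw (\<lambda>(A, E). graph_dist {1..n} A E) (codes n) (labeled_members n)"
  unfolding bij_betw_def
proof
  show "inj_on (\<lambda>(A, E). graph_dist {1..n} A E) (codes n)"
    unfolding inj_on_def codes_def using graph_dist_inj[where V = "{1..n}" and v = 1] by auto
  show "(\<lambda>(A, E). graph_dist {1..n} A E) ` codes n = labeled_members n"
  proof
    show "(\<lambda>(A, E). graph_dist {1..n} A E) ` codes n \<subseteq> labeled_members n"
    proof clarify
      fix A E
      show "graph_dist {1..n} A E \<in> labeled_members n"
        using bipartite_space_graph_dist unfolding labeled_members_iff by (simp add: graph_dist_def)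
    qed
    show "labeled_members n \<subseteq> (\<lambda>(A, E). graph_dist {1..n} A E) ` codes n"
    proof
      fix d assume "d \<in> labeled_members n"
      then obtain A E where "A \<subseteq> {1..n}" "1 \<in> A" "E \<subseteq> cross {1..n} A" "graph_dist {1..n} A E = d"
        using graph_dist_surj[of "{1..n}" d 1] assms unfolding labeled_members_iff by auto
      then show "d \<in> (\<lambda>(A, E). graph_dist {1..n} A E) ` codes n"
        unfolding codes_def by (intro image_eqI[of _ _ "(A, E)"]) auto
    qed
  qed
qed

lemma finite_codes: "finite (codes n)"
  unfolding codes_def
proof (rule finite_SigmaI)
  show "finite {A. A \<subseteq> {1..n} \<and> 1 \<in> A}" by (rule finite_subset[of _ "Pow {1..n}"]) auto
qed (use finite_cross[of "{1..n}"] in simp)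

text \<open>Independence: the events \<open>E \<inter> Q z = R z\<close> for disjoint blocks \<open>Q z\<close>, each of
  probability \<open>1 / 2 ^ q\<close>.\<close>

lemma card_avoiding_blocks_le:
  assumes "finite P" "finite Z" "\<And>z. z \<in> Z \<Longrightarrow> Q z \<subseteq> P" "\<And>z. z \<in> Z \<Longrightarrow> card (Q z) = q"
    "\<And>z. z \<in> Z \<Longrightarrow> R z \<subseteq> Q z" "disjoint_family_on Q Z"
  shows "real (card {E \<in> Pow P. \<forall>z\<in>Z. E \<inter> Q z \<noteq> R z}) \<le> 2 ^ card P * (1 - 1 / 2 ^ q) ^ card Z"
  using assms(2,1,3-)
proof (induction Z arbitrary: P rule: finite_induct)
  case empty
  then show ?case by (simp add: card_Pow flip: Pow_def)
next
  case (insert z Z)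
  define P' where "P' = P - Q z"
  have fin: "finite (Q z)" "finite P'"
    using insert.prems(1,2) finite_subset unfolding P'_def by blast+
  have disj: "Q z \<inter> Q z' = {}" if "z' \<in> Z" for z'
    by (rule insert.prems(5)[unfolded disjoint_family_on_def, rule_format])
      (use insert.hyps(2) that in auto)
  have QP: "Q z' \<subseteq> P'" if "z' \<in> Z" for z'
    using disj[OF that] insert.prems(2) that unfolding P'_def by blast
  have cP: "card P = q + card P'"
    using insert.prems(3)[of z] card_Diff_subset[OF fin(1) insert.prems(2)[of z]]
      card_mono[OF insert.prems(1,2), of z] unfolding P'_def by simp
  have IH: "real (card {E \<in> Pow P'. \<forall>z\<in>Z. E \<inter> Q z \<noteq> R z}) \<le> 2 ^ card P' * (1 - 1 / 2 ^ q) ^ card Z"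
  proof (rule insert.IH)
    show "disjoint_family_on Q Z" by (rule disjoint_family_on_mono[OF _ insert.prems(5)]) auto
  qed (use insert.prems(3,4) QP fin in simp_all)
  \<comment> \<open>\<open>E\<close> is split into its trace on \<open>Q z\<close>, for which only
    \<open>R z\<close> is forbidden, and the rest, to which the induction hypothesis
    applies.\<close>
  have "card {E \<in> Pow P. \<forall>z\<in>insert z Z. E \<inter> Q z \<noteq> R z}
      \<le> card ((Pow (Q z) - {R z}) \<times> {E \<in> Pow P'. \<forall>z\<in>Z. E \<inter> Q z \<noteq> R z})"
  proof (rule card_inj_on_le)
    show "inj_on (\<lambda>E. (E \<inter> Q z, E - Q z)) {E \<in> Pow P. \<forall>z\<in>insert z Z. E \<inter> Q z \<noteq> R z}"
      by (rule inj_onI) auto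
    have "(E - Q z) \<inter> Q z' = E \<inter> Q z'" if "z' \<in> Z" for E z' using disj[OF that] by blast
    then show "(\<lambda>E. (E \<inter> Q z, E - Q z)) ` {E \<in> Pow P. \<forall>z\<in>insert z Z. E \<inter> Q z \<noteq> R z}
      \<subseteq> (Pow (Q z) - {R z}) \<times> {E \<in> Pow P'. \<forall>z\<in>Z. E \<inter> Q z \<noteq> R z}"
      unfolding P'_def by auto
  qed (use fin in auto)
  also have "\<dots> = (2 ^ q - 1) * card {E \<in> Pow P'. \<forall>z\<in>Z. E \<inter> Q z \<noteq> R z}"
    using insert.prems(3,4) fin by (simp add: card_cartesian_product card_Diff_singleton card_Pow)
  finally have "real (card {E \<in> Pow P. \<forall>z\<in>insert z Z. E \<inter> Q z \<noteq> R z})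
      \<le> real ((2 ^ q - 1) * card {E \<in> Pow P'. \<forall>z\<in>Z. E \<inter> Q z \<noteq> R z})"
    by (simp only: of_nat_le_iff)
  also have "\<dots> = (2 ^ q - 1) * real (card {E \<in> Pow P'. \<forall>z\<in>Z. E \<inter> Q z \<noteq> R z})"
    by (simp add: of_nat_diff)
  also have "\<dots> \<le> (2 ^ q - 1) * (2 ^ card P' * (1 - 1 / 2 ^ q) ^ card Z)"
    by (rule mult_left_mono[OF IH]) simp
  also have "\<dots> = 2 ^ card P * (1 - 1 / 2 ^ q) ^ card (insert z Z)"
    using insert.hyps by (simp add: cP power_add field_simps)
  finally show ?case .
qed

section \<open>Rarity of graphs that fail the extension property\<close>

text \<open>A set with at most \<open>k\<close> elements is the set of letters of a word of length
  exactly \<open>k\<close>, padded with the blank letter \<open>None\<close>.\<close>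

lemma card_small_subsets_le:
  assumes "finite V"
  shows "card {X. X \<subseteq> V \<and> card X \<le> k} \<le> (card V + 1) ^ k"
proof -
  define L where "L = {xs. set xs \<subseteq> insert None (Some ` V) \<and> length xs = k}"
  have fin: "finite (insert None (Some ` V))" using assms by simp
  have "X \<in> (\<lambda>xs. {x. Some x \<in> set xs}) ` L" if X: "X \<subseteq> V" "card X \<le> k" for X
  proof -
    obtain ys where ys: "set ys = X" "distinct ys"
      using finite_distinct_list finite_subset[OF X(1) assms] by blast
    then have "length ys \<le> k" using X(2) distinct_card by fastforce
    then have "map Some ys @ replicate (k - length ys) None \<in> L"
      using ys X by (auto simp: L_def)
    moreover have "X = {x. Some x \<in> set (map Some ys @ replicate (k - length ys) None)}"
      using ys by auto
    ultimately show ?thesis by blast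
  qed
  then have "{X. X \<subseteq> V \<and> card X \<le> k} \<subseteq> (\<lambda>xs. {x. Some x \<in> set xs}) ` L" by blast
  moreover have "finite L" unfolding L_def by (rule finite_lists_length_eq[OF fin])
  ultimately have "card {X. X \<subseteq> V \<and> card X \<le> k} \<le> card L"
    by (meson surj_card_le)
  also have "\<dots> = card (insert None (Some ` V)) ^ k" unfolding L_def by (rule card_lists_length_eq[OF fin])
  also have "card (insert None (Some ` V)) = card V + 1" using assms by (simp add: card_image)
  finally show ?thesis .
qed

text \<open>An unrealised distance pattern fixes the part \<open>Y\<close> in which a realising
  point would lie. Distances inside that part are 2 anyway, so only the prescribed neighbourhood
  \<open>S\<close> in the opposite part can go wrong, and it does so for every candidate
  \<open>z\<close>. These events concern disjoint sets of pairs for different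
  \<open>z\<close>.\<close>

lemma not_one_point_ext_graph_dist:
  assumes "A \<subseteq> V" and ne: "\<not> one_point_ext k V (graph_dist V A E)"
  shows "\<exists>X Y S. X \<subseteq> V \<and> finite X \<and> card X \<le> k \<and> (Y = A \<or> Y = V - A) \<and> S \<subseteq> X - Y \<and>
    (\<forall>z\<in>Y - X. E \<inter> (\<lambda>w. {z, w}) ` (X - Y) \<noteq> (\<lambda>w. {z, w}) ` S)"
proof -
  let ?d = "graph_dist V A E"
  obtain X f where X: "X \<subseteq> V" "finite X" "card X \<le> k" and f: "\<forall>x\<in>X. f x \<in> {1, 2, 3}"
    "\<forall>x\<in>X. \<forall>y\<in>X. x \<noteq> y \<longrightarrow> (?d x y = 2) = ((f x = 2) = (f y = 2))"
    and no: "\<not> (\<exists>z\<in>V - X. \<forall>x\<in>X. ?d z x = f x)"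
    using ne unfolding one_point_ext_def not_all not_imp
    by (elim exE conjE) (rule that; assumption)
  have "\<exists>s. \<forall>x\<in>X. f x = 2 \<longleftrightarrow> (x \<in> A \<longleftrightarrow> s)"
  proof (rule one_point_type_side)
    show "(?d x y = 2) = ((f x = 2) = (f y = 2))" if "x \<in> X" "y \<in> X" "x \<noteq> y" for x y
      using f(2) that by blast
    show "?d x y = 2 \<longleftrightarrow> (x \<in> A \<longleftrightarrow> y \<in> A)" if "x \<in> X" "y \<in> X" "x \<noteq> y" for x y
      using graph_dist_coloring that X(1) by (meson subsetD)
  qed
  then obtain s where s: "\<And>x. x \<in> X \<Longrightarrow> f x = 2 \<longleftrightarrow> (x \<in> A \<longleftrightarrow> s)" by blast
  define Y where "Y = (if s then A else V - A)"
  define S where "S = {x \<in> X - Y. f x = 1}"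
  have Y: "x \<in> Y \<longleftrightarrow> (x \<in> A \<longleftrightarrow> s)" if "x \<in> V" for x using that by (auto simp: Y_def)
  have YV: "Y \<subseteq> V" using assms(1) by (auto simp: Y_def)
  have "\<forall>z\<in>Y - X. E \<inter> (\<lambda>w. {z, w}) ` (X - Y) \<noteq> (\<lambda>w. {z, w}) ` S"
  proof (intro ballI notI)
    fix z assume z: "z \<in> Y - X"
    assume eq: "E \<inter> (\<lambda>w. {z, w}) ` (X - Y) = (\<lambda>w. {z, w}) ` S"
    have "?d z x = f x" if x: "x \<in> X" for x
    proof (cases "x \<in> Y")
      case True
      then have "f x = 2" using s[OF x] Y x X(1) by blast
      moreover have "?d z x = 2" using graph_dist_coloring[of z V x A E] Y x X(1) z YV True by blast
      ultimately show ?thesis by simp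
    next
      case False
      have "{z, x} \<in> E \<longleftrightarrow> {z, x} \<in> E \<inter> (\<lambda>w. {z, w}) ` (X - Y)" using x False by blast
      also have "\<dots> \<longleftrightarrow> {z, x} \<in> (\<lambda>w. {z, w}) ` S" by (simp only: eq)
      also have "\<dots> \<longleftrightarrow> x \<in> S" by (auto simp: doubleton_eq_iff)
      also have "\<dots> \<longleftrightarrow> f x = 1" using x False by (simp add: S_def)
      finally have 1: "{z, x} \<in> E \<longleftrightarrow> f x = 1" .
      have "z \<in> V" "x \<in> V" "z \<noteq> x" using z x YV X(1) by auto
      moreover have "(z \<in> A) \<noteq> (x \<in> A)" using Y z x False X(1) YV by blast
      moreover have "f x \<in> {1, 3}" using f(1) s[OF x] Y[of x] x False X(1) by blast
      ultimately show ?thesis using 1 unfolding graph_dist_def by auto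
    qed
    then show False using no z YV by blast
  qed
  moreover have "Y = A \<or> Y = V - A" "S \<subseteq> X - Y" by (auto simp: Y_def S_def)
  ultimately show ?thesis
    using X by (intro exI[of _ X] exI[of _ Y] exI[of _ S] conjI)
qed

text \<open>A union bound over the triples (X, Y, S): the sets \<open>X\<close> and \<open>S\<close>
  and the choice of a part give the polynomial factor. For each triple at least \<open>m - k\<close>
  candidates in \<open>Y\<close> must fail independently, each with probability at most 1 - 1 / 2 ^
  k.\<close>

lemma card_not_one_point_ext_le:
  assumes V: "finite V" "A \<subseteq> V" and m: "m \<le> card A" "m \<le> card (V - A)"
  shows "real (card {E \<in> Pow (cross V A). \<not> one_point_ext k V (graph_dist V A E)})
    \<le> 2 * (real (card V) + 1) ^ (2 * k) * (1 - 1 / 2 ^ k) ^ (m - k) * 2 ^ card (cross V A)"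
proof -
  define K where "K = {X. X \<subseteq> V \<and> card X \<le> k}"
  define W where "W X Y S = {E \<in> Pow (cross V A). \<forall>z\<in>Y - X. E \<inter> (\<lambda>w. {z, w}) ` (X - Y) \<noteq> (\<lambda>w. {z, w}) ` S}"
    for X Y S
  define c where "c = 1 - 1 / (2 :: real) ^ k"
  define I where "I = {(X, Y, S). X \<in> K \<and> Y \<in> {A, V - A} \<and> S \<in> K \<and> S \<subseteq> X - Y}"
  have c: "0 \<le> c" "c \<le> 1" by (auto simp: c_def)
  have fK: "finite K" unfolding K_def using V(1) by (auto intro: finite_subset[of _ "Pow V"])
  have IK: "I \<subseteq> K \<times> {A, V - A} \<times> K" unfolding I_def by auto
  then have fI: "finite I" using fK finite_subset by blast
  have "card I \<le> card (K \<times> {A, V - A} \<times> K)" using fK by (intro card_mono[OF _ IK]) auto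
  also have "\<dots> = card K * (card {A, V - A} * card K)" by (simp only: card_cartesian_product)
  also have "\<dots> \<le> (card V + 1) ^ k * (2 * (card V + 1) ^ k)"
    using card_small_subsets_le[OF V(1), of k] unfolding K_def
    by (intro mult_mono card_insert_le_m1) auto
  also have "\<dots> = 2 * (card V + 1) ^ (2 * k)" by (simp add: power_even_eq power2_eq_square)
  finally have "real (card I) \<le> real (2 * (card V + 1) ^ (2 * k))" by (simp only: of_nat_le_iff)
  then have cI: "real (card I) \<le> 2 * (real (card V) + 1) ^ (2 * k)" by (simp add: add.commute)
  have W: "real (card (W X Y S)) \<le> 2 ^ card (cross V A) * c ^ (m - k)"
    if "X \<subseteq> V" "card X \<le> k" "Y \<in> {A, V - A}" "S \<subseteq> X - Y" for X Y S
  proof -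
    define q where "q = card (X - Y)"
    have fin: "finite X" "finite Y" using that V finite_subset by auto
    have qk: "q \<le> k" unfolding q_def using that(2) fin by (meson card_mono Diff_subset le_trans)
    have "real (card (W X Y S)) \<le> 2 ^ card (cross V A) * (1 - 1 / 2 ^ q) ^ card (Y - X)"
      unfolding W_def
    proof (rule card_avoiding_blocks_le)
      show "finite (cross V A)" by (rule finite_cross[OF V])
      show "finite (Y - X)" using fin by simp
      show "(\<lambda>w. {z, w}) ` (X - Y) \<subseteq> cross V A" if "z \<in> Y - X" for z
        using that \<open>Y \<in> {A, V - A}\<close> \<open>X \<subseteq> V\<close> V(2) by (intro image_subsetI crossI) auto
      show "card ((\<lambda>w. {z, w}) ` (X - Y)) = q" for z
        unfolding q_def by (rule card_image) (auto simp: inj_on_def doubleton_eq_iff)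
      show "disjoint_family_on (\<lambda>z. (\<lambda>w. {z, w}) ` (X - Y)) (Y - X)"
        by (auto simp: disjoint_family_on_def doubleton_eq_iff)
    qed (use that in auto)
    also have "\<dots> \<le> 2 ^ card (cross V A) * c ^ (m - k)"
    proof (rule mult_left_mono)
      have "m \<le> card Y" using that(3) m by auto
      then have "m - k \<le> card (Y - X)" using that(2) diff_card_le_card_Diff[OF fin(1), of Y] by linarith
      moreover have "1 / (2::real) ^ k \<le> 1 / 2 ^ q" using qk by (intro divide_left_mono power_increasing) auto
      ultimately have "(1 - 1 / 2 ^ q) ^ card (Y - X) \<le> c ^ card (Y - X)"
        by (intro power_mono) (auto simp: c_def)
      also have "\<dots> \<le> c ^ (m - k)" using c \<open>m - k \<le> _\<close> by (rule power_decreasing[rotated])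
      finally show "(1 - 1 / 2 ^ q) ^ card (Y - X) \<le> c ^ (m - k)" .
    qed simp
    finally show ?thesis .
  qed
  have "{E \<in> Pow (cross V A). \<not> one_point_ext k V (graph_dist V A E)} \<subseteq> (\<Union>(X, Y, S)\<in>I. W X Y S)"
  proof
    fix E assume E: "E \<in> {E \<in> Pow (cross V A). \<not> one_point_ext k V (graph_dist V A E)}"
    then have "\<not> one_point_ext k V (graph_dist V A E)" by simp
    from not_one_point_ext_graph_dist[OF V(2) this]
    obtain X Y S where XYS: "X \<subseteq> V" "finite X" "card X \<le> k" "Y = A \<or> Y = V - A" "S \<subseteq> X - Y"
      "\<forall>z\<in>Y - X. E \<inter> (\<lambda>w. {z, w}) ` (X - Y) \<noteq> (\<lambda>w. {z, w}) ` S"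
      by (elim exE conjE) (rule that; assumption)
    have "card S \<le> k" using XYS by (meson Diff_subset card_mono le_trans subset_trans)
    then have "(X, Y, S) \<in> I" using XYS by (auto simp: I_def K_def)
    moreover have "E \<in> W X Y S" using E XYS by (simp add: W_def)
    ultimately show "E \<in> (\<Union>(X, Y, S)\<in>I. W X Y S)" by blast
  qed
  then have "card {E \<in> Pow (cross V A). \<not> one_point_ext k V (graph_dist V A E)}
      \<le> card (\<Union>(X, Y, S)\<in>I. W X Y S)"
    using fI finite_cross[OF V] by (intro card_mono) (auto simp: W_def)
  also have "\<dots> \<le> (\<Sum>(X, Y, S)\<in>I. card (W X Y S))"
    using card_UN_le[OF fI, of "\<lambda>(X, Y, S). W X Y S"] by (simp add: case_prod_unfold)
  finally have "real (card {E \<in> Pow (cross V A). \<not> one_point_ext k V (graph_dist V A E)})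
      \<le> real (\<Sum>(X, Y, S)\<in>I. card (W X Y S))" by (simp only: of_nat_le_iff)
  also have "\<dots> = (\<Sum>(X, Y, S)\<in>I. real (card (W X Y S)))"
    by (simp add: case_prod_unfold)
  also have "\<dots> \<le> (\<Sum>_\<in>I. 2 ^ card (cross V A) * c ^ (m - k))"
    using W by (intro sum_mono) (auto simp: I_def K_def)
  also have "\<dots> = real (card I) * (2 ^ card (cross V A) * c ^ (m - k))" by simp
  also have "\<dots> \<le> (2 * (real (card V) + 1) ^ (2 * k)) * (2 ^ card (cross V A) * c ^ (m - k))"
    using cI c by (intro mult_right_mono) auto
  finally show ?thesis by (simp add: c_def mult_ac)
qed

section \<open>Counting automorphisms\<close>

definition autos :: "'a set \<Rightarrow> ('a \<Rightarrow> 'a \<Rightarrow> real) \<Rightarrow> ('a \<Rightarrow> 'a) set" where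
  "autos V d = {\<sigma>. \<sigma> permutes V \<and> (\<forall>x\<in>V. \<forall>y\<in>V. d (\<sigma> x) (\<sigma> y) = d x y)}"

definition moved :: "('a \<Rightarrow> 'a) \<Rightarrow> 'a set" where
  "moved \<sigma> = {x. \<sigma> x \<noteq> x}"

lemma moved_subset: "\<sigma> permutes V \<Longrightarrow> moved \<sigma> \<subseteq> V"
  unfolding moved_def permutes_def by auto

text \<open>If \<open>T\<close> is maximal with \<open>f ` T\<close> and \<open>T\<close> disjoint, then every moved point of \<open>D\<close> lies in
  \<open>T\<close>, \<open>f ` T\<close> or the preimage of \<open>T\<close>.\<close>

lemma exists_displaced_third:
  assumes "finite D" "inj_on f D" "\<And>p. p \<in> D \<Longrightarrow> f p \<noteq> p"
  shows "\<exists>T\<subseteq>D. f ` T \<inter> T = {} \<and> card D \<le> 3 * card T"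
proof -
  let ?ok = "\<lambda>T. T \<subseteq> D \<and> f ` T \<inter> T = {}"
  have "finite {T. ?ok T}" by (rule finite_subset[of _ "Pow D"]) (use assms(1) in auto)
  moreover have "{} \<in> {T. ?ok T}" by simp
  ultimately have "\<exists>T\<in>{T. ?ok T}. {} \<subseteq> T \<and> (\<forall>T'\<in>{T. ?ok T}. T \<subseteq> T' \<longrightarrow> T = T')"
    by (rule finite_has_maximal2)
  then obtain T where T: "?ok T" and TC: "\<forall>T'\<in>{T. ?ok T}. T \<subseteq> T' \<longrightarrow> T = T'"
    by (elim bexE conjE CollectE) (rule that; blast)
  have max: "T = T'" if "?ok T'" "T \<subseteq> T'" for T'
    by (rule TC[rule_format]) (use that in simp_all)
  have fT: "finite T" using T assms(1) finite_subset by blast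
  have "D \<subseteq> T \<union> f ` T \<union> {p\<in>D. f p \<in> T}"
  proof
    fix p assume p: "p \<in> D"
    show "p \<in> T \<union> f ` T \<union> {p\<in>D. f p \<in> T}"
    proof (rule ccontr)
      assume not: "p \<notin> T \<union> f ` T \<union> {p\<in>D. f p \<in> T}"
      then have "?ok (insert p T)" using T p assms(3)[OF p] by auto
      then show False using max[of "insert p T"] not by blast
    qed
  qed
  then have "card D \<le> card (T \<union> f ` T \<union> {p\<in>D. f p \<in> T})"
    using fT assms(1) by (intro card_mono) auto
  also have "\<dots> \<le> card T + card (f ` T) + card {p\<in>D. f p \<in> T}"
    by (meson card_Un_le le_trans add_right_mono)
  also have "card (f ` T) \<le> card T" by (rule card_image_le[OF fT])
  also have "card {p\<in>D. f p \<in> T} \<le> card T"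
    by (rule card_inj_on_le[of f]) (use assms(2) fT in \<open>auto simp: inj_on_def\<close>)
  finally show ?thesis using T by (intro exI[of _ T]) simp
qed

text \<open>For \<open>p\<close> in \<open>T\<close>, membership of \<open>p\<close> in an invariant
  set can be read off at \<open>f p\<close>, which is outside \<open>T\<close>; hence the set is
  determined by its part outside \<open>T\<close>.\<close>

lemma card_invariant_le:
  assumes "finite P" "T \<subseteq> P" "f ` T \<inter> T = {}" "\<And>E. E \<in> W \<Longrightarrow> E \<subseteq> P"
    and "\<And>E p. E \<in> W \<Longrightarrow> p \<in> P \<Longrightarrow> f p \<in> E \<longleftrightarrow> p \<in> E"
  shows "card W \<le> 2 ^ (card P - card T)"
proof -
  have "card W \<le> card (Pow (P - T))"
  proof (rule card_inj_on_le)
    have sub: "E \<subseteq> E'" if E: "E \<in> W" "E' \<in> W" "E - T = E' - T" for E E'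
    proof
      fix p assume p: "p \<in> E"
      show "p \<in> E'"
      proof (cases "p \<in> T")
        case True
        then have "f p \<in> E" "f p \<notin> T" using assms(2,3) assms(5)[OF E(1), of p] p by auto
        then have "f p \<in> E'" using E(3) by blast
        then show ?thesis using assms(5)[OF E(2), of p] True assms(2) by auto
      qed (use E(3) p in blast)
    qed
    show "inj_on (\<lambda>E. E - T) W" by (rule inj_onI) (simp add: sub subset_antisym)
    show "(\<lambda>E. E - T) ` W \<subseteq> Pow (P - T)" using assms(4) by blast
  qed (use assms(1) in simp)
  also have "\<dots> = 2 ^ (card P - card T)"
    using assms(1,2) by (simp add: card_Pow card_Diff_subset finite_subset[OF assms(2,1)])
  finally show ?thesis .
qed

text \<open>Double counting. A moved point \<open>x\<close> and a point \<open>y\<close> of the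
  opposite part form a displaced pair unless \<open>y\<close> is the image of \<open>x\<close>,
  since otherwise the image of the pair contains a point outside it; this exception costs the 1 in
  \<open>m - 1\<close>. The factor 2 is there because a pair may be counted from both of its
  points.\<close>

lemma card_displaced_ge:
  assumes V: "finite V" "A \<subseteq> V" and "S \<subseteq> V" and moves: "\<And>x. x \<in> S \<Longrightarrow> \<sigma> x \<noteq> x"
    and m: "m \<le> card A" "m \<le> card (V - A)"
  shows "card S * (m - 1) \<le> 2 * card {p \<in> cross V A. \<sigma> ` p \<noteq> p}"
proof -
  let ?D = "{p \<in> cross V A. \<sigma> ` p \<noteq> p}"
  have fin: "finite ?D" "finite S" using finite_cross[OF V] V assms(3) finite_subset by auto
  have ge: "m - 1 \<le> card {p \<in> ?D. x \<in> p}" if x: "x \<in> S" for x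
  proof -
    define O' where "O' = (if x \<in> A then V - A else A)"
    have O': "finite O'" "m \<le> card O'" using V m finite_subset by (auto simp: O'_def)
    have "m - 1 \<le> card (O' - {\<sigma> x})" using O' by (auto simp: card_Diff_singleton_if)
    also have "\<dots> = card ((\<lambda>y. {x, y}) ` (O' - {\<sigma> x}))"
      by (rule card_image[symmetric]) (auto simp: inj_on_def doubleton_eq_iff)
    also have "\<dots> \<le> card {p \<in> ?D. x \<in> p}"
    proof (rule card_mono)
      show "(\<lambda>y. {x, y}) ` (O' - {\<sigma> x}) \<subseteq> {p \<in> ?D. x \<in> p}"
      proof (rule image_subsetI)
        fix y assume y: "y \<in> O' - {\<sigma> x}"
        have "{x, y} \<in> cross V A"
          by (rule crossI) (use x y assms(2,3) in \<open>auto simp: O'_def split: if_splits\<close>)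
        moreover have "\<sigma> x \<notin> {x, y}" using moves[OF x] y by auto
        ultimately show "{x, y} \<in> {p \<in> ?D. x \<in> p}" by auto
      qed
    qed (rule rev_finite_subset[OF fin(1)], blast)
    finally show ?thesis .
  qed
  have "card S * (m - 1) = (\<Sum>x\<in>S. m - 1)" by simp
  also have "\<dots> \<le> (\<Sum>x\<in>S. card {p \<in> ?D. x \<in> p})" by (rule sum_mono[OF ge])
  also have "\<dots> = (\<Sum>p\<in>?D. card {x \<in> S. x \<in> p})"
    using sum.swap_restrict[OF fin(2,1), of "\<lambda>_ _. 1::nat" "\<lambda>x p. x \<in> p"] by simp
  also have "\<dots> \<le> (\<Sum>p\<in>?D. 2)"
  proof (rule sum_mono)
    fix p assume "p \<in> ?D"
    then obtain x y where "p = {x, y}" using crossE[OF _ V(2)] by blast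
    then have "card {x \<in> S. x \<in> p} \<le> card {x, y}" by (intro card_mono) auto
    then show "card {x \<in> S. x \<in> p} \<le> 2" using card_insert_le_m1[of 2 "{y}" x] by simp
  qed
  finally show ?thesis by (simp add: mult.commute)
qed

text \<open>An automorphism may exchange the two parts, but it preserves distance 2, hence the cross
  pairs, and among these it preserves distance 1, hence the edges.\<close>

lemma autos_graph_dist_cross:
  assumes "A \<subseteq> V" "\<sigma> \<in> autos V (graph_dist V A E)" "p \<in> cross V A"
  shows "\<sigma> ` p \<in> cross V A" "\<sigma> ` p \<in> E \<longleftrightarrow> p \<in> E"
proof -
  obtain x y where xy: "p = {x, y}" "x \<in> A" "y \<in> V - A" using crossE[OF assms(3,1)] by blast
  have s: "\<sigma> permutes V" "graph_dist V A E (\<sigma> x) (\<sigma> y) = graph_dist V A E x y"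
    using assms(1,2) xy by (auto simp: autos_def)
  have V: "x \<in> V" "y \<in> V" "x \<noteq> y" "\<sigma> x \<in> V" "\<sigma> y \<in> V" "\<sigma> x \<noteq> \<sigma> y"
    using xy assms(1) permutes_in_image[OF s(1)] permutes_inj[OF s(1)] by (auto simp: inj_eq)
  have "(\<sigma> x \<in> A) \<noteq> (\<sigma> y \<in> A)"
    using s(2) V xy by (auto simp: graph_dist_def split: if_splits)
  then show "\<sigma> ` p \<in> cross V A" using V xy(1) by (auto intro: crossI)
  show "\<sigma> ` p \<in> E \<longleftrightarrow> p \<in> E"
    using s(2) V xy \<open>(\<sigma> x \<in> A) \<noteq> (\<sigma> y \<in> A)\<close> by (auto simp: graph_dist_def split: if_splits)
qed

text \<open>The 6 is 2 * 3: a moved point accounts for at least (m - 1) / 2 displaced cross pairs,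
  and a third of the displaced pairs can be chosen disjoint from their images. Each chosen pair
  halves the bound on the number of invariant graphs.\<close>

lemma card_invariant_graphs_le:
  assumes V: "finite V" "A \<subseteq> V" and s: "\<sigma> permutes V" and m: "m \<le> card A" "m \<le> card (V - A)"
  shows "real (card {E \<in> Pow (cross V A). \<sigma> \<in> autos V (graph_dist V A E)})
    \<le> 2 ^ card (cross V A) * (2 powr (- (real m - 1) / 6)) ^ card (moved \<sigma>)"
proof (cases "{E \<in> Pow (cross V A). \<sigma> \<in> autos V (graph_dist V A E)} = {}")
  case False
  then obtain E0 where "\<sigma> \<in> autos V (graph_dist V A E0)" by blast
  define D where "D = {p \<in> cross V A. \<sigma> ` p \<noteq> p}"
  have fin: "finite (cross V A)" "finite D" using finite_cross[OF V] by (auto simp: D_def)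
  have "inj_on ((`) \<sigma>) D" using permutes_inj[OF s] by (simp add: inj_on_def inj_image_eq_iff)
  then have "\<exists>T\<subseteq>D. (`) \<sigma> ` T \<inter> T = {} \<and> card D \<le> 3 * card T"
    by (rule exists_displaced_third[OF fin(2)]) (simp add: D_def)
  then obtain T where T: "T \<subseteq> D" "(`) \<sigma> ` T \<inter> T = {}" "card D \<le> 3 * card T"
    by (elim exE conjE) (rule that)
  have TP: "T \<subseteq> cross V A" using T(1) by (auto simp: D_def)
  have "card (moved \<sigma>) * (m - 1) \<le> 2 * card D"
    unfolding D_def by (rule card_displaced_ge[OF V moved_subset[OF s] _ m]) (simp add: moved_def)
  then have "card (moved \<sigma>) * (m - 1) \<le> 6 * card T" using T(3) by linarith
  then have "real (card (moved \<sigma>) * (m - 1)) \<le> real (6 * card T)" by (simp only: of_nat_le_iff)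
  then have "real (card (moved \<sigma>)) * real (m - 1) \<le> 6 * real (card T)"
    by (simp only: of_nat_mult of_nat_numeral)
  moreover have "real (card (moved \<sigma>)) * (real m - 1) \<le> real (card (moved \<sigma>)) * real (m - 1)"
    by (intro mult_left_mono) auto
  ultimately have t: "real (card (moved \<sigma>)) * (real m - 1) \<le> 6 * real (card T)" by linarith
  have "card {E \<in> Pow (cross V A). \<sigma> \<in> autos V (graph_dist V A E)} \<le> 2 ^ (card (cross V A) - card T)"
    by (rule card_invariant_le[OF fin(1) TP T(2)]) (use autos_graph_dist_cross(2)[OF V(2)] in auto)
  then have "real (card {E \<in> Pow (cross V A). \<sigma> \<in> autos V (graph_dist V A E)})
      \<le> real (2 ^ (card (cross V A) - card T))" by (simp only: of_nat_le_iff)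
  also have "\<dots> = (2 :: real) ^ (card (cross V A) - card T)" by simp
  also have "\<dots> = 2 ^ card (cross V A) * 2 powr (- real (card T))"
    using card_mono[OF fin(1) TP] by (simp add: power_diff powr_minus_divide powr_realpow)
  also have "\<dots> \<le> 2 ^ card (cross V A) * 2 powr (real (card (moved \<sigma>)) * (- (real m - 1) / 6))"
  proof (intro mult_left_mono powr_mono)
    show "- real (card T) \<le> real (card (moved \<sigma>)) * (- (real m - 1) / 6)"
      using t by (simp add: field_simps)
  qed auto
  also have "2 powr (real (card (moved \<sigma>)) * (- (real m - 1) / 6))
      = (2 powr (- (real m - 1) / 6)) ^ card (moved \<sigma>)"
    by (simp add: powr_power mult.commute)
  finally show ?thesis .
next
  case True
  show ?thesis unfolding True by simp
qed

section \<open>Summation over all permutations\<close>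

lemma sum_power_card_Pow:
  fixes x :: real
  assumes "finite V" shows "(\<Sum>S\<in>Pow V. x ^ card S) = (1 + x) ^ card V"
  using prod_add[OF assms, of "\<lambda>_. x" "\<lambda>_. 1"] by (simp add: add.commute)

text \<open>Permutations are grouped by their set \<open>S\<close> of moved points. There are at
  most \<open>fact (card S)\<close> of them, which is bounded by \<open>card V ^ card S\<close>, and
  the binomial theorem sums the resulting powers.\<close>

lemma sum_power_card_moved_le:
  fixes q :: real
  assumes V: "finite V" and q: "0 \<le> q"
  shows "(\<Sum>\<sigma> | \<sigma> permutes V. q ^ card (moved \<sigma>)) \<le> (1 + card V * q) ^ card V"
proof -
  have fin: "finite {\<sigma>. \<sigma> permutes S}" if "S \<in> Pow V" for S
    using that V finite_subset finite_permutations by auto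
  have "(\<Sum>\<sigma> | \<sigma> permutes V. q ^ card (moved \<sigma>))
      = (\<Sum>(S, \<sigma>)\<in>(\<lambda>\<sigma>. (moved \<sigma>, \<sigma>)) ` {\<sigma>. \<sigma> permutes V}. q ^ card S)"
    by (subst sum.reindex) (auto simp: inj_on_def)
  also have "\<dots> \<le> (\<Sum>(S, \<sigma>)\<in>(SIGMA S:Pow V. {\<sigma>. \<sigma> permutes S}). q ^ card S)"
  proof (rule sum_mono2)
    show "finite (SIGMA S:Pow V. {\<sigma>. \<sigma> permutes S})" using V fin by auto
    have "\<sigma> permutes moved \<sigma>" if "\<sigma> permutes V" for \<sigma>
      using that unfolding permutes_def moved_def by auto
    then show "(\<lambda>\<sigma>. (moved \<sigma>, \<sigma>)) ` {\<sigma>. \<sigma> permutes V} \<subseteq> (SIGMA S:Pow V. {\<sigma>. \<sigma> permutes S})"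
      using moved_subset by fastforce
  qed (use q in auto)
  also have "\<dots> = (\<Sum>S\<in>Pow V. \<Sum>\<sigma> | \<sigma> permutes S. q ^ card S)"
    using V fin by (intro sum.Sigma[symmetric]) auto
  also have "\<dots> = (\<Sum>S\<in>Pow V. fact (card S) * q ^ card S)"
    using card_permutations[OF refl finite_subset[OF _ V]] by (intro sum.cong) auto
  also have "\<dots> \<le> (\<Sum>S\<in>Pow V. (card V * q) ^ card S)"
  proof (rule sum_mono)
    fix S assume "S \<in> Pow V"
    then have "card S \<le> card V" using V card_mono by auto
    have "(fact (card S) :: real) \<le> real (card S ^ card S)" by (rule fact_le_power)
    also have "\<dots> \<le> real (card V) ^ card S" using \<open>card S \<le> card V\<close> by (simp add: power_mono)
    finally show "fact (card S) * q ^ card S \<le> (card V * q) ^ card S"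
      using q by (simp add: power_mult_distrib mult_right_mono)
  qed
  also have "\<dots> = (1 + card V * q) ^ card V" by (rule sum_power_card_Pow[OF V])
  finally show ?thesis .
qed

text \<open>Pairs of a bad graph and an automorphism are split by whether the automorphism is
  \<open>id\<close>. For \<open>id\<close> the rarity of bad graphs is used. For the others badness
  is dropped, as invariance alone is rare enough; the final \<open>- 1\<close> removes the summand
  of \<open>id\<close>, which moves nothing.\<close>

lemma sum_card_autos_balanced_le:
  assumes V: "finite V" "A \<subseteq> V" and m: "m \<le> card A" "m \<le> card (V - A)"
  shows "(\<Sum>E \<in> {E \<in> Pow (cross V A). \<not> one_point_ext k V (graph_dist V A E)}.
        real (card (autos V (graph_dist V A E))))
    \<le> 2 ^ card (cross V A) *
      (2 * (real (card V) + 1) ^ (2 * k) * (1 - 1 / 2 ^ k) ^ (m - k)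
        + ((1 + card V * 2 powr (- (real m - 1) / 6)) ^ card V - 1))"
proof -
  define B where "B = {E \<in> Pow (cross V A). \<not> one_point_ext k V (graph_dist V A E)}"
  define q where "q = (2 :: real) powr (- (real m - 1) / 6)"
  define Q where "Q = {\<sigma>. \<sigma> permutes V} - {id}"
  have fin: "finite B" "finite Q" "finite (cross V A)"
    using finite_cross[OF V] finite_permutations[OF V(1)] by (auto simp: B_def Q_def)
  have id: "id \<in> autos V d" for d by (simp add: autos_def permutes_id)
  have "real (card (autos V d)) = 1 + (\<Sum>\<sigma>\<in>Q. if \<sigma> \<in> autos V d then 1 else (0::real))" for d
  proof -
    have "autos V d = insert id {\<sigma>\<in>Q. \<sigma> \<in> autos V d}" using id by (auto simp: Q_def autos_def)
    then have "card (autos V d) = card (insert id {\<sigma>\<in>Q. \<sigma> \<in> autos V d})" by (rule arg_cong)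
    also have "\<dots> = Suc (card {\<sigma>\<in>Q. \<sigma> \<in> autos V d})"
      by (rule card_insert_disjoint) (use fin(2) in \<open>simp_all add: Q_def\<close>)
    finally have "card (autos V d) = Suc (card {\<sigma>\<in>Q. \<sigma> \<in> autos V d})" .
    then show ?thesis using fin(2) by (simp add: sum.If_cases Int_def)
  qed
  then have "(\<Sum>E\<in>B. real (card (autos V (graph_dist V A E))))
      = real (card B) + (\<Sum>E\<in>B. \<Sum>\<sigma>\<in>Q. if \<sigma> \<in> autos V (graph_dist V A E) then 1 else (0::real))"
    by (simp add: sum.distrib)
  also have "(\<Sum>E\<in>B. \<Sum>\<sigma>\<in>Q. if \<sigma> \<in> autos V (graph_dist V A E) then 1 else (0::real))
      = (\<Sum>\<sigma>\<in>Q. \<Sum>E\<in>B. if \<sigma> \<in> autos V (graph_dist V A E) then 1 else 0)"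
    by (rule sum.swap)
  also have "\<dots> \<le> (\<Sum>\<sigma>\<in>Q. 2 ^ card (cross V A) * q ^ card (moved \<sigma>))"
  proof (rule sum_mono)
    fix \<sigma> assume "\<sigma> \<in> Q"
    then have s: "\<sigma> permutes V" by (simp add: Q_def)
    have "(\<Sum>E\<in>B. if \<sigma> \<in> autos V (graph_dist V A E) then 1 else (0::real))
        = real (card {E\<in>B. \<sigma> \<in> autos V (graph_dist V A E)})"
      using fin(1) by (simp add: sum.If_cases Int_def)
    also have "\<dots> \<le> real (card {E \<in> Pow (cross V A). \<sigma> \<in> autos V (graph_dist V A E)})"
      using fin(3) by (intro of_nat_mono card_mono) (auto simp: B_def)
    also have "\<dots> \<le> 2 ^ card (cross V A) * q ^ card (moved \<sigma>)"
      unfolding q_def by (rule card_invariant_graphs_le[OF V s m])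
    finally show "(\<Sum>E\<in>B. if \<sigma> \<in> autos V (graph_dist V A E) then 1 else (0::real))
        \<le> 2 ^ card (cross V A) * q ^ card (moved \<sigma>)" .
  qed
  also have "\<dots> = 2 ^ card (cross V A) * ((\<Sum>\<sigma> | \<sigma> permutes V. q ^ card (moved \<sigma>)) - 1)"
  proof -
    have "(\<Sum>\<sigma> | \<sigma> permutes V. q ^ card (moved \<sigma>)) = q ^ card (moved (id :: 'a \<Rightarrow> 'a)) + (\<Sum>\<sigma>\<in>Q. q ^ card (moved \<sigma>))"
      unfolding Q_def using finite_permutations[OF V(1)] by (intro sum.remove) (auto simp: permutes_id)
    then show ?thesis by (simp add: moved_def sum_distrib_left)
  qed
  also have "\<dots> \<le> 2 ^ card (cross V A) * ((1 + card V * q) ^ card V - 1)"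
    using sum_power_card_moved_le[OF V(1), of q] by (intro mult_left_mono) (auto simp: q_def)
  also have "real (card B) \<le> 2 ^ card (cross V A) * (2 * (real (card V) + 1) ^ (2 * k) * (1 - 1 / 2 ^ k) ^ (m - k))"
    using card_not_one_point_ext_le[OF V m, of k] by (simp add: B_def mult_ac)
  finally show ?thesis by (simp add: B_def q_def distrib_left)
qed

section \<open>Asymptotics\<close>

definition non_generic :: "nat \<Rightarrow> nat \<Rightarrow> (nat \<Rightarrow> nat \<Rightarrow> real) set" where
  "non_generic k n = {d \<in> labeled_members n. \<not> one_point_ext k {1..n} d}"

lemma card_labeled_members:
  assumes "n \<ge> 1"
  shows "card (labeled_members n) = (\<Sum>A | A \<subseteq> {1..n} \<and> 1 \<in> A. 2 ^ card (cross {1..n} A))"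
proof -
  have "card (labeled_members n) = card (codes n)"
    using bij_betw_same_card[OF bij_betw_labeled_members[OF assms]] by simp
  also have "\<dots> = (\<Sum>A | A \<subseteq> {1..n} \<and> 1 \<in> A. card (Pow (cross {1..n} A)))"
    unfolding codes_def by (rule card_SigmaI) (auto intro: finite_subset[of _ "Pow {1..n}"] finite_cross)
  also have "\<dots> = (\<Sum>A | A \<subseteq> {1..n} \<and> 1 \<in> A. 2 ^ card (cross {1..n} A))"
    by (rule sum.cong) (auto simp: card_Pow finite_cross)
  finally show ?thesis .
qed

lemma sum_card_autos_non_generic:
  assumes "n \<ge> 1"
  shows "(\<Sum>d\<in>non_generic k n. real (card (autos {1..n} d))) =
    (\<Sum>A | A \<subseteq> {1..n} \<and> 1 \<in> A.
      \<Sum>E | E \<in> Pow (cross {1..n} A) \<and> \<not> one_point_ext k {1..n} (graph_dist {1..n} A E).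
        real (card (autos {1..n} (graph_dist {1..n} A E))))"
proof -
  let ?g = "\<lambda>(A, E). graph_dist {1..n} A E"
  let ?C = "SIGMA A:{A. A \<subseteq> {1..n} \<and> 1 \<in> A}.
    {E \<in> Pow (cross {1..n} A). \<not> one_point_ext k {1..n} (graph_dist {1..n} A E)}"
  have C: "?C = {c \<in> codes n. \<not> one_point_ext k {1..n} (?g c)}"
    unfolding codes_def by auto
  have bij: "inj_on ?g (codes n)" "?g ` codes n = labeled_members n"
    using bij_betw_labeled_members[OF assms] unfolding bij_betw_def by auto
  have inj: "inj_on ?g ?C" unfolding C by (rule inj_on_subset[OF bij(1)]) blast
  have "g ` {c \<in> C. P (g c)} = {d \<in> g ` C. P d}" for g :: "'c \<Rightarrow> 'd" and C P by auto
  then have im: "?g ` ?C = non_generic k n" unfolding C non_generic_def bij(2)[symmetric] .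
  have "(\<Sum>d\<in>non_generic k n. real (card (autos {1..n} d)))
      = (\<Sum>c\<in>?C. real (card (autos {1..n} (?g c))))"
    unfolding im[symmetric] by (subst sum.reindex[OF inj]) simp
  also have "\<dots> = (\<Sum>(A, E)\<in>?C. real (card (autos {1..n} (graph_dist {1..n} A E))))"
    by (simp add: case_prod_unfold)
  also have "\<dots> = (\<Sum>A | A \<subseteq> {1..n} \<and> 1 \<in> A.
      \<Sum>E | E \<in> Pow (cross {1..n} A) \<and> \<not> one_point_ext k {1..n} (graph_dist {1..n} A E).
        real (card (autos {1..n} (graph_dist {1..n} A E))))"
    by (rule sum.Sigma[symmetric])
      (auto intro: finite_subset[of _ "Pow {1..n}"] finite_subset[OF _ finite_Pow_iff[THEN iffD2, OF finite_cross]])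
  finally show ?thesis .
qed

text \<open>A single bipartition with parts of sizes \<open>n div 2\<close> and
  \<open>n - n div 2\<close> already provides this many graphs; the -1 accounts for odd
  \<open>n\<close>.\<close>

lemma card_labeled_members_ge:
  assumes "n \<ge> 1"
  shows "2 powr ((real n * real n - 1) / 4) \<le> real (card (labeled_members n))"
proof -
  define h where "h = n div 2"
  define A where "A = {1..n - h}"
  have A: "A \<subseteq> {1..n}" "1 \<in> A" "card A = n - h" "card ({1..n} - A) = h"
    using assms by (auto simp: A_def h_def card_Diff_subset)
  have "(real n * real n - 1) / 4 \<le> real (card (cross {1..n} A))"
  proof -
    have cc: "card (cross {1..n} A) = (n - h) * h" by (simp only: card_cross A(3,4))
    have "n = 2 * h \<or> n = 2 * h + 1" unfolding h_def by linarith
    then show ?thesis unfolding cc by (elim disjE) (simp_all add: algebra_simps)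
  qed
  then have "2 powr ((real n * real n - 1) / 4) \<le> 2 powr real (card (cross {1..n} A))" by simp
  also have "\<dots> = real (2 ^ card (cross {1..n} A))" by (simp add: powr_realpow)
  also have "\<dots> \<le> real (card (labeled_members n))"
    unfolding card_labeled_members[OF assms] of_nat_le_iff
    by (rule member_le_sum) (use A in \<open>auto intro: finite_subset[of _ "Pow {1..n}"]\<close>)
  finally show ?thesis .
qed

text \<open>The factor \<epsilon> covers bipartitions with both parts of size at least
  \<open>b\<close>. The last summand covers the others: at most 2 ^ n bipartitions, each with at
  most \<open>b * n\<close> cross pairs, and crudely at most n ^ n automorphisms for every
  graph.\<close>

lemma sum_card_autos_non_generic_le:
  fixes n k :: nat
  defines "b \<equiv> n div 8"
  defines "\<epsilon> \<equiv> 2 * (real n + 1) ^ (2 * k) * (1 - 1 / 2 ^ k) ^ (b - k)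
        + ((1 + real n * 2 powr (- (real b - 1) / 6)) ^ n - 1)"
  assumes "n \<ge> 1"
  shows "(\<Sum>d\<in>non_generic k n. real (card (autos {1..n} d)))
    \<le> \<epsilon> * real (card (labeled_members n)) + 2 ^ n * (2 ^ (b * n) * real n ^ n)"
proof -
  let ?As = "{A. A \<subseteq> {1..n} \<and> 1 \<in> A}"
  have fin: "finite ?As" by (rule finite_subset[of _ "Pow {1..n}"]) auto
  have eps: "\<epsilon> \<ge> 0" unfolding \<epsilon>_def by (intro add_nonneg_nonneg) (auto intro!: mult_nonneg_nonneg)
  have bound: "(\<Sum>E | E \<in> Pow (cross {1..n} A) \<and> \<not> one_point_ext k {1..n} (graph_dist {1..n} A E).
        real (card (autos {1..n} (graph_dist {1..n} A E))))
      \<le> 2 ^ card (cross {1..n} A) * \<epsilon> + 2 ^ (b * n) * real n ^ n" (is "sum ?w ?B \<le> _")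
    if A: "A \<subseteq> {1..n}" for A
  proof (cases "b \<le> card A \<and> b \<le> card ({1..n} - A)")
    case True
    then have "sum ?w ?B \<le> 2 ^ card (cross {1..n} A) * \<epsilon>"
      using sum_card_autos_balanced_le[of "{1..n}" A b k] A by (simp add: \<epsilon>_def)
    also have "\<dots> \<le> 2 ^ card (cross {1..n} A) * \<epsilon> + 2 ^ (b * n) * real n ^ n" by simp
    finally show ?thesis .
  next
    case False
    have w: "?w E \<le> real n ^ n" for E
    proof -
      have "card (autos {1..n} (graph_dist {1..n} A E)) \<le> card {\<sigma>. \<sigma> permutes {1..n}}"
        by (rule card_mono) (auto simp: autos_def finite_permutations)
      also have "\<dots> = fact n" by (rule card_permutations) auto
      also have "\<dots> \<le> n ^ n" using fact_le_power[of n, where 'a = nat] by simp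
      finally have "?w E \<le> real (n ^ n)" by (simp only: of_nat_le_iff)
      then show ?thesis by simp
    qed
    have "card A \<le> n" "card ({1..n} - A) \<le> n"
      using A card_mono[of "{1..n}" A] card_mono[of "{1..n}" "{1..n} - A"] by auto
    then have "card (cross {1..n} A) \<le> b * n"
      using False mult_le_mono[of "card A" b "card ({1..n} - A)" n]
        mult_le_mono[of "card A" n "card ({1..n} - A)" b] by (auto simp: card_cross mult.commute)
    then have c: "(2::real) ^ card (cross {1..n} A) \<le> 2 ^ (b * n)" by (intro power_increasing) auto
    have finP: "finite (Pow (cross {1..n} A))" using A by (simp add: finite_cross)
    have "card ?B \<le> card (Pow (cross {1..n} A))" by (rule card_mono[OF finP]) auto
    also have "\<dots> = 2 ^ card (cross {1..n} A)" using A by (simp add: card_Pow finite_cross)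
    finally have "real (card ?B) \<le> real (2 ^ card (cross {1..n} A))" by (simp only: of_nat_le_iff)
    also have "\<dots> = 2 ^ card (cross {1..n} A)" by (simp only: of_nat_power of_nat_numeral)
    also note c
    finally have cB: "real (card ?B) \<le> 2 ^ (b * n)" .
    have "sum ?w ?B \<le> real (card ?B) * real n ^ n" using sum_bounded_above[of ?B ?w] w by simp
    also have "\<dots> \<le> 2 ^ (b * n) * real n ^ n" using cB by (rule mult_right_mono) simp
    also have "\<dots> \<le> 2 ^ card (cross {1..n} A) * \<epsilon> + 2 ^ (b * n) * real n ^ n" using eps by simp
    finally show ?thesis .
  qed
  have "(\<Sum>d\<in>non_generic k n. real (card (autos {1..n} d)))
      \<le> (\<Sum>A\<in>?As. 2 ^ card (cross {1..n} A) * \<epsilon> + 2 ^ (b * n) * real n ^ n)"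
    unfolding sum_card_autos_non_generic[OF assms(3)] by (rule sum_mono) (use bound in simp)
  also have "\<dots> = \<epsilon> * real (card (labeled_members n)) + real (card ?As) * (2 ^ (b * n) * real n ^ n)"
    by (simp add: card_labeled_members[OF assms(3)] sum.distrib sum_distrib_left mult.commute)
  also have "real (card ?As) \<le> 2 ^ n"
  proof -
    have "card ?As \<le> card (Pow {1..n})" by (rule card_mono) auto
    then have "real (card ?As) \<le> real (2 ^ n)" by (simp add: card_Pow)
    then show ?thesis by simp
  qed
  finally show ?thesis by (simp add: mult_right_mono)
qed

lemma tendsto_autos_non_generic:
  "(\<lambda>n. (\<Sum>d\<in>non_generic k n. real (card (autos {1..n} d))) / real (card (labeled_members n)))
    \<longlonglongrightarrow> 0"
proof -
  \<comment> \<open>Taking \<open>Suc k\<close> instead of \<open>k\<close> keeps the argument of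
    the logarithm positive when \<open>k = 0\<close>, at the price of a slightly weaker
    bound.\<close>
  define t where "t = - ln (1 - 1 / 2 ^ Suc k :: real)"
  have c: "0 < (1 - 1 / 2 ^ Suc k :: real)" "(1 - 1 / 2 ^ Suc k :: real) < 1"
    using one_less_power[of "2::real" "Suc k"] by (auto simp: field_simps simp del: power_Suc)
  have t: "t > 0" using c by (simp add: t_def)
  \<comment> \<open>The summands stand for failed extensions, nontrivial automorphisms and
    unbalanced bipartitions. \<open>n div 8\<close> is replaced by n / 8 - 1 from below and n / 8
    from above, which leaves a closed expression in \<open>n\<close>.\<close>
  define f where "f n = 2 * (real n + 1) ^ (2 * k) * exp (- t * (real n / 8 - (1 + real k)))
    + ((1 + real n * 2 powr (- (real n / 8 - 2) / 6)) ^ n - 1)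
    + 2 ^ n * (2 powr (real n * real n / 8) * real n ^ n) / 2 powr ((real n * real n - 1) / 4)" for n
  have "(\<lambda>n. 2 * (real n + 1) ^ (2 * k) * exp (- t * (real n / 8 - (1 + real k)))) \<longlonglongrightarrow> 0"
    using t by real_asymp
  moreover have "(\<lambda>n. (1 + real n * 2 powr (- (real n / 8 - 2) / 6)) ^ n - 1) \<longlonglongrightarrow> 0"
    by real_asymp
  moreover have "(\<lambda>n. 2 ^ n * (2 powr (real n * real n / 8) * real n ^ n) / 2 powr ((real n * real n - 1) / 4)) \<longlonglongrightarrow> 0"
    by real_asymp
  ultimately have "f \<longlonglongrightarrow> 0 + 0 + 0" unfolding f_def by (intro tendsto_add)
  then have f: "f \<longlonglongrightarrow> 0" by simp
  have le: "(\<Sum>d\<in>non_generic k n. real (card (autos {1..n} d))) / real (card (labeled_members n)) \<le> f n"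
    if n: "n \<ge> 1" for n
  proof -
    define b where "b = n div 8"
    define L where "L = real (card (labeled_members n))"
    have b: "real n / 8 - 1 \<le> real b" "real b \<le> real n / 8" unfolding b_def by linarith+
    have Lge: "2 powr ((real n * real n - 1) / 4) \<le> L"
      unfolding L_def by (rule card_labeled_members_ge[OF n])
    then have L: "L > 0" by (smt (verit) powr_gt_zero)
    have "(1 - 1 / 2 ^ k) ^ (b - k) \<le> (1 - 1 / 2 ^ Suc k :: real) ^ (b - k)"
      by (rule power_mono) (auto simp: field_simps)
    also have "\<dots> = exp (- t * real (b - k))"
      unfolding powr_realpow[OF c(1), symmetric] using c(1)
      by (simp only: t_def powr_def minus_minus mult.commute if_False less_irrefl split: if_split) simp
    also have "\<dots> \<le> exp (- t * (real n / 8 - (1 + real k)))"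
    proof -
      have "real n / 8 - (1 + real k) \<le> real (b - k)" using b by linarith
      then have "t * (real n / 8 - (1 + real k)) \<le> t * real (b - k)" using t by (intro mult_left_mono) auto
      then show ?thesis by simp
    qed
    finally have 1: "2 * (real n + 1) ^ (2 * k) * (1 - 1 / 2 ^ k) ^ (b - k)
        \<le> 2 * (real n + 1) ^ (2 * k) * exp (- t * (real n / 8 - (1 + real k)))"
      by (rule mult_left_mono) simp
    have "2 powr (- (real b - 1) / 6) \<le> 2 powr (- (real n / 8 - 2) / (6::real))"
      using b(1) by (intro powr_mono) (auto simp: field_simps)
    then have 2: "(1 + real n * 2 powr (- (real b - 1) / 6)) ^ n
        \<le> (1 + real n * 2 powr (- (real n / 8 - 2) / 6)) ^ n"
      by (intro power_mono add_left_mono mult_left_mono) auto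
    have "2 ^ (b * n) = 2 powr (real b * real n)" by (simp add: powr_realpow flip: of_nat_mult)
    also have "\<dots> \<le> 2 powr (real n * real n / 8)"
      using mult_right_mono[OF b(2), of "real n"] by (intro powr_mono) simp_all
    finally have "2 ^ n * (2 ^ (b * n) * real n ^ n) \<le> 2 ^ n * (2 powr (real n * real n / 8) * real n ^ n)"
      by (intro mult_left_mono mult_right_mono) auto
    then have 3: "2 ^ n * (2 ^ (b * n) * real n ^ n) / L
        \<le> 2 ^ n * (2 powr (real n * real n / 8) * real n ^ n) / 2 powr ((real n * real n - 1) / 4)"
      using Lge by (intro frac_le) auto
    have "(\<Sum>d\<in>non_generic k n. real (card (autos {1..n} d))) / L
      \<le> ((2 * (real n + 1) ^ (2 * k) * (1 - 1 / 2 ^ k) ^ (b - k)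
          + ((1 + real n * 2 powr (- (real b - 1) / 6)) ^ n - 1)) * L
          + 2 ^ n * (2 ^ (b * n) * real n ^ n)) / L"
      using sum_card_autos_non_generic_le[OF n, of k] L unfolding L_def b_def
      by (intro divide_right_mono) auto
    also have "\<dots> = 2 * (real n + 1) ^ (2 * k) * (1 - 1 / 2 ^ k) ^ (b - k)
          + ((1 + real n * 2 powr (- (real b - 1) / 6)) ^ n - 1) + 2 ^ n * (2 ^ (b * n) * real n ^ n) / L"
      using L by (simp add: add_divide_distrib)
    also have "\<dots> \<le> f n" unfolding f_def using 1 2 3 by linarith
    finally show ?thesis unfolding L_def .
  qed
  show ?thesis
  proof (rule tendsto_sandwich[OF _ _ tendsto_const f])
    show "\<forall>\<^sub>F n in sequentially. 0 \<le> (\<Sum>d\<in>non_generic k n. real (card (autos {1..n} d))) / real (card (labeled_members n))"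
      by (auto intro!: always_eventually divide_nonneg_nonneg sum_nonneg)
    show "\<forall>\<^sub>F n in sequentially. (\<Sum>d\<in>non_generic k n. real (card (autos {1..n} d))) / real (card (labeled_members n)) \<le> f n"
      using le by (rule eventually_sequentiallyI)
  qed
qed

section \<open>Isometry classes\<close>

text \<open>The pushforward of \<open>d\<close>, which makes \<sigma> an isometry onto the result;
  isometry classes are the orbits of this action of the permutations of {1..n}.\<close>

definition transport :: "('a \<Rightarrow> 'a) \<Rightarrow> ('a \<Rightarrow> 'a \<Rightarrow> real) \<Rightarrow> 'a \<Rightarrow> 'a \<Rightarrow> real" where
  "transport \<sigma> d = (\<lambda>x y. d (inv \<sigma> x) (inv \<sigma> y))"

lemma transport_eq_iff:
  assumes "\<sigma> permutes V"
  shows "transport \<sigma> d = e \<longleftrightarrow> (\<forall>x y. e (\<sigma> x) (\<sigma> y) = d x y)"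
proof
  assume "transport \<sigma> d = e"
  then show "\<forall>x y. e (\<sigma> x) (\<sigma> y) = d x y"
    using permutes_inverses(2)[OF assms] by (auto simp: transport_def)
next
  assume "\<forall>x y. e (\<sigma> x) (\<sigma> y) = d x y"
  then have "e x y = d (inv \<sigma> x) (inv \<sigma> y)" for x y
    using permutes_inverses(1)[OF assms] by metis
  then show "transport \<sigma> d = e" unfolding transport_def by (intro ext) simp
qed

lemma bipartite_space_transport:
  assumes "bipartite_space V d" "\<sigma> permutes V"
  shows "bipartite_space V (transport \<sigma> d)"
proof -
  note D = bipartite_spaceD[OF assms(1)]
  let ?i = "inv \<sigma>"
  have i: "?i permutes V" by (rule permutes_inv[OF assms(2)])
  have iV: "?i x \<in> V" if "x \<in> V" for x using permutes_in_image[OF i] that by simp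
  have ne: "?i x \<noteq> ?i y" if "x \<noteq> y" for x y using permutes_inj[OF i] that by (simp add: inj_eq)
  show ?thesis
    unfolding bipartite_space_def transport_def
  proof (intro conjI allI ballI impI)
    show "0 \<le> d (?i x) (?i y)" for x y by (rule D(1))
    show "d (?i x) (?i y) = d (?i y) (?i x)" for x y by (rule D(2))
    show "d (?i x) (?i x) = 0" if "x \<in> V" for x by (rule D(3)[OF iV[OF that]])
    show "d (?i x) (?i y) \<in> {1, 2, 3}" if "x \<in> V" "y \<in> V" "x \<noteq> y" for x y
      using that iV ne by (intro D(4)) auto
    show "(d (?i x) (?i y) = 2) = ((d (?i y) (?i z) = 2) = (d (?i x) (?i z) = 2))"
      if "x \<in> V" "y \<in> V" "z \<in> V" "x \<noteq> y \<and> y \<noteq> z \<and> x \<noteq> z" for x y z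
      using that iV ne by (intro D(5)) auto
  qed
qed

lemma transport_labeled_members:
  assumes "d \<in> labeled_members n" "\<sigma> permutes {1..n}"
  shows "transport \<sigma> d \<in> labeled_members n"
proof -
  have "transport \<sigma> d x y = 0" if "x \<notin> {1..n} \<or> y \<notin> {1..n}" for x y
  proof -
    have "inv \<sigma> x \<notin> {1..n} \<or> inv \<sigma> y \<notin> {1..n}"
      using that permutes_in_image[OF permutes_inv[OF assms(2)]] by blast
    then show ?thesis using assms(1) unfolding labeled_members_iff transport_def by blast
  qed
  then show ?thesis
    using assms bipartite_space_transport unfolding labeled_members_iff by blast
qed

lemma one_point_ext_transport:
  assumes "one_point_ext k V d" "\<sigma> permutes V"
  shows "one_point_ext k V (transport \<sigma> d)"
  unfolding one_point_ext_def
proof (intro allI impI, elim conjE)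
  fix X and f :: "'a \<Rightarrow> real"
  assume X: "X \<subseteq> V" "finite X" "card X \<le> k" and f: "\<forall>x\<in>X. f x \<in> {1, 2, 3}"
    "\<forall>x\<in>X. \<forall>y\<in>X. x \<noteq> y \<longrightarrow> (transport \<sigma> d x y = 2) = ((f x = 2) = (f y = 2))"
  let ?i = "inv \<sigma>"
  have i: "?i permutes V" by (rule permutes_inv[OF assms(2)])
  have si: "\<sigma> (?i x) = x" and ins: "?i (\<sigma> x) = x" for x
    using permutes_inverses[OF assms(2)] by auto
  have "\<exists>z\<in>V - ?i ` X. \<forall>x\<in>?i ` X. d z x = (f \<circ> \<sigma>) x"
  proof (rule assms(1)[unfolded one_point_ext_def, rule_format], intro conjI ballI impI)
    show "?i ` X \<subseteq> V" using X(1) permutes_in_image[OF i] by auto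
    show "finite (?i ` X)" using X(2) by simp
    show "card (?i ` X) \<le> k" using X(2,3) card_image_le le_trans by blast
    show "(f \<circ> \<sigma>) x \<in> {1, 2, 3}" if "x \<in> ?i ` X" for x using that f(1) si by fastforce
    show "(d x y = 2) = (((f \<circ> \<sigma>) x = 2) = ((f \<circ> \<sigma>) y = 2))"
      if xy: "x \<in> ?i ` X" "y \<in> ?i ` X" "x \<noteq> y" for x y
    proof -
      obtain u v where uv: "x = ?i u" "u \<in> X" "y = ?i v" "v \<in> X" using xy by blast
      then have "u \<noteq> v" using xy(3) by blast
      then have "(transport \<sigma> d u v = 2) = ((f u = 2) = (f v = 2))" using f(2) uv by blast
      then show ?thesis by (simp add: uv si transport_def)
    qed
  qed
  then obtain z where z: "z \<in> V" "z \<notin> ?i ` X" "\<And>x. x \<in> X \<Longrightarrow> d z (?i x) = f x"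
    by (auto simp: si)
  have "\<sigma> z \<in> V - X" using z(1,2) permutes_in_image[OF assms(2)] ins by (metis DiffI image_eqI)
  moreover have "\<forall>x\<in>X. transport \<sigma> d (\<sigma> z) x = f x" using z(3) by (simp add: transport_def ins)
  ultimately show "\<exists>z\<in>V - X. \<forall>x\<in>X. transport \<sigma> d z x = f x" by blast
qed

lemma isometry_rel_iff:
  "(d, e) \<in> isometry_rel n \<longleftrightarrow>
     d \<in> labeled_members n \<and> (\<exists>\<sigma>. \<sigma> permutes {1..n} \<and> e = transport \<sigma> d)"
proof
  assume "(d, e) \<in> isometry_rel n"
  then obtain f where d: "d \<in> labeled_members n" and e: "e \<in> labeled_members n"
    and f: "bij_betw f {1..n} {1..n}" "\<And>x y. x \<in> {1..n} \<Longrightarrow> y \<in> {1..n} \<Longrightarrow> e (f x) (f y) = d x y"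
    unfolding isometry_rel_def isometric_def isometry_between_def by blast
  \<comment> \<open>Extending by the identity turns the isometry into a permutation, and distances
    to points off the universe are 0 in both structures.\<close>
  define \<sigma> where "\<sigma> x = (if x \<in> {1..n} then f x else x)" for x
  have "bij_betw \<sigma> {1..n} {1..n}"
    using f(1) by (rule bij_betw_cong[THEN iffD1, rotated]) (simp add: \<sigma>_def)
  then have p: "\<sigma> permutes {1..n}" by (rule bij_imp_permutes) (auto simp: \<sigma>_def)
  have "e (\<sigma> x) (\<sigma> y) = d x y" for x y
    using f(2)[of x y] d e by (auto simp: \<sigma>_def labeled_members_iff)
  then have "e = transport \<sigma> d" using transport_eq_iff[OF p, of d e] by blast
  then show "d \<in> labeled_members n \<and> (\<exists>\<sigma>. \<sigma> permutes {1..n} \<and> e = transport \<sigma> d)"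
    using d p by blast
next
  assume "d \<in> labeled_members n \<and> (\<exists>\<sigma>. \<sigma> permutes {1..n} \<and> e = transport \<sigma> d)"
  then obtain \<sigma> where d: "d \<in> labeled_members n" and s: "\<sigma> permutes {1..n}" "e = transport \<sigma> d"
    by blast
  have "\<forall>x y. e (\<sigma> x) (\<sigma> y) = d x y" by (rule transport_eq_iff[OF s(1), THEN iffD1]) (simp add: s(2))
  then have "isometric {1..n} d {1..n} e"
    unfolding isometric_def isometry_between_def using permutes_imp_bij[OF s(1)] by blast
  then show "(d, e) \<in> isometry_rel n"
    using d transport_labeled_members[OF d s(1)] s(2) by (simp add: isometry_rel_def)
qed

lemma isometry_rel_Image:
  assumes "d \<in> labeled_members n"
  shows "isometry_rel n `` {d} = (\<lambda>\<sigma>. transport \<sigma> d) ` {\<sigma>. \<sigma> permutes {1..n}}"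
  using assms by (auto simp: isometry_rel_iff)

lemma equiv_isometry_rel: "equiv (labeled_members n) (isometry_rel n)"
proof (rule equivI)
  show "isometry_rel n \<subseteq> labeled_members n \<times> labeled_members n"
    by (auto simp: isometry_rel_def)
  show "refl_on (labeled_members n) (isometry_rel n)"
  proof (rule refl_onI)
    fix d assume "d \<in> labeled_members n"
    moreover have "d = transport id d" by (simp add: transport_def)
    ultimately show "(d, d) \<in> isometry_rel n" unfolding isometry_rel_iff using permutes_id by blast
  qed
  show "sym (isometry_rel n)"
  proof (rule symI)
    fix d e assume "(d, e) \<in> isometry_rel n"
    then obtain \<sigma> where s: "d \<in> labeled_members n" "\<sigma> permutes {1..n}" "e = transport \<sigma> d"
      by (auto simp: isometry_rel_iff)
    have "d = transport (inv \<sigma>) e"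
      unfolding s(3) transport_def by (simp add: permutes_inv_inv[OF s(2)] permutes_inverses[OF s(2)])
    moreover have "e \<in> labeled_members n" using transport_labeled_members[OF s(1,2)] s(3) by simp
    ultimately show "(e, d) \<in> isometry_rel n"
      unfolding isometry_rel_iff
      using permutes_inv[OF s(2)] by (intro conjI exI[of _ "inv \<sigma>"])
  qed
  show "trans (isometry_rel n)"
  proof (rule transI)
    fix d e f assume "(d, e) \<in> isometry_rel n" "(e, f) \<in> isometry_rel n"
    then obtain \<sigma> \<tau> where s: "d \<in> labeled_members n" "\<sigma> permutes {1..n}" "\<tau> permutes {1..n}"
        "f = transport \<tau> (transport \<sigma> d)"
      by (auto simp: isometry_rel_iff)
    have "f = transport (\<tau> \<circ> \<sigma>) d"
      unfolding s(4) transport_def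
      by (simp add: o_inv_distrib[OF permutes_bij[OF s(3)] permutes_bij[OF s(2)]])
    then show "(d, f) \<in> isometry_rel n"
      using permutes_compose[OF s(2,3)] s(1) unfolding isometry_rel_iff by blast
  qed
qed

lemma card_isometry_class_le:
  assumes "C \<in> unlabeled_members n"
  shows "finite C" "card C \<le> fact n"
proof -
  obtain d where d: "d \<in> labeled_members n" "C = isometry_rel n `` {d}"
    using assms unfolding unlabeled_members_def by (rule quotientE)
  have fin: "finite {\<sigma>. \<sigma> permutes {1..n}}" by (simp add: finite_permutations)
  show "finite C" unfolding d(2) isometry_rel_Image[OF d(1)] using fin by simp
  have "card C \<le> card {\<sigma>. \<sigma> permutes {1..n}}"
    unfolding d(2) isometry_rel_Image[OF d(1)] by (rule card_image_le[OF fin])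
  also have "\<dots> = fact n" by (rule card_permutations) auto
  finally show "card C \<le> fact n" .
qed

text \<open>The orbit-counting inequality: the permutations carrying a fixed member of \<open>C\<close> to \<open>e\<close> form
  a coset of the automorphism group of \<open>e\<close>.\<close>

lemma fact_le_sum_card_autos:
  assumes "C \<in> unlabeled_members n"
  shows "fact n \<le> (\<Sum>e\<in>C. card (autos {1..n} e))"
proof -
  obtain d where d: "d \<in> labeled_members n" "C = isometry_rel n `` {d}"
    using assms unfolding unlabeled_members_def by (rule quotientE)
  let ?S = "{\<sigma>. \<sigma> permutes {1..n}}"
  let ?F = "\<lambda>e. {\<sigma> \<in> ?S. transport \<sigma> d = e}"
  have fin: "finite ?S" by (simp add: finite_permutations)
  have C: "C = (\<lambda>\<sigma>. transport \<sigma> d) ` ?S" unfolding d(2) isometry_rel_Image[OF d(1)] ..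
  have "fact n = (\<Sum>\<sigma>\<in>?S. 1)" using card_permutations[of "{1..n}" n] by simp
  also have "\<dots> = (\<Sum>e\<in>C. \<Sum>\<sigma>\<in>?F e. 1)" unfolding C by (rule sum.image_gen[OF fin])
  also have "\<dots> = (\<Sum>e\<in>C. card (?F e))" by simp
  also have "\<dots> \<le> (\<Sum>e\<in>C. card (autos {1..n} e))"
  proof (rule sum_mono)
    fix e assume "e \<in> C"
    then obtain \<tau> where t: "\<tau> permutes {1..n}" "transport \<tau> d = e" unfolding C by auto
    show "card (?F e) \<le> card (autos {1..n} e)"
    proof (rule card_inj_on_le)
      show "inj_on (\<lambda>\<sigma>. \<sigma> \<circ> inv \<tau>) (?F e)"
      proof (rule inj_onI)
        fix \<sigma> \<sigma>' assume eq: "\<sigma> \<circ> inv \<tau> = \<sigma>' \<circ> inv \<tau>"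
        have "\<sigma> x = \<sigma>' x" for x
          using fun_cong[OF eq, of "\<tau> x"] permutes_inverses(2)[OF t(1), of x] by simp
        then show "\<sigma> = \<sigma>'" by (intro ext)
      qed
      show "(\<lambda>\<sigma>. \<sigma> \<circ> inv \<tau>) ` ?F e \<subseteq> autos {1..n} e"
      proof (rule image_subsetI)
        fix \<sigma> assume s: "\<sigma> \<in> ?F e"
        then have "\<forall>x y. e (\<sigma> x) (\<sigma> y) = d x y" using transport_eq_iff by blast
        moreover have "e x y = d (inv \<tau> x) (inv \<tau> y)" for x y
          unfolding t(2)[symmetric] transport_def ..
        ultimately have "e ((\<sigma> \<circ> inv \<tau>) x) ((\<sigma> \<circ> inv \<tau>) y) = e x y" for x y by simp
        moreover have "\<sigma> \<circ> inv \<tau> permutes {1..n}"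
          using s permutes_compose[OF permutes_inv[OF t(1)]] by simp
        ultimately show "\<sigma> \<circ> inv \<tau> \<in> autos {1..n} e" by (simp add: autos_def)
      qed
      show "finite (autos {1..n} e)"
        by (rule finite_subset[OF _ fin]) (auto simp: autos_def)
    qed
  qed
  finally show ?thesis .
qed

section \<open>Comparing counts of classes with counts of labeled structures\<close>

lemma finite_labeled_members:
  assumes "n \<ge> 1" shows "finite (labeled_members n)"
  using bij_betw_finite[OF bij_betw_labeled_members[OF assms]] finite_codes by simp

lemma finite_unlabeled_members:
  assumes "n \<ge> 1" shows "finite (unlabeled_members n)"
  unfolding unlabeled_members_def
  by (rule finite_quotient[OF finite_labeled_members[OF assms]]) (auto simp: isometry_rel_def)

lemma card_labeled_members_pos:
  assumes "n \<ge> 1" shows "0 < card (labeled_members n)"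
  using card_labeled_members_ge[OF assms] by (smt (verit) gr0I of_nat_0 powr_gt_zero)

lemma card_labeled_members_le:
  assumes "n \<ge> 1"
  shows "card (labeled_members n) \<le> fact n * card (unlabeled_members n)"
proof -
  have "card (labeled_members n) = card (\<Union>(unlabeled_members n))"
    unfolding unlabeled_members_def using Union_quotient[OF equiv_isometry_rel] by simp
  also have "\<dots> \<le> (\<Sum>C\<in>unlabeled_members n. card C)" by (rule card_Union_le_sum_card)
  also have "\<dots> \<le> (\<Sum>C\<in>unlabeled_members n. fact n)" by (rule sum_mono) (rule card_isometry_class_le)
  finally show ?thesis by (simp add: mult.commute)
qed

text \<open>The extension property is invariant under transport, so its failure is a property of
  isometry classes.\<close>

lemma non_generic_class:
  assumes "C \<in> unlabeled_members n" "C \<inter> non_generic k n \<noteq> {}"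
  shows "C \<subseteq> non_generic k n"
proof
  fix e assume e: "e \<in> C"
  obtain d where d: "d \<in> C" "d \<in> non_generic k n" using assms(2) by blast
  have "(e, d) \<in> isometry_rel n"
    using in_quotient_imp_in_rel[OF equiv_isometry_rel assms(1)[unfolded unlabeled_members_def]] d e
    by blast
  then obtain \<sigma> where "e \<in> labeled_members n" "\<sigma> permutes {1..n}" "d = transport \<sigma> e"
    unfolding isometry_rel_iff by blast
  then show "e \<in> non_generic k n"
    using d(2) one_point_ext_transport[of k "{1..n}" e \<sigma>] unfolding non_generic_def by blast
qed

text \<open>The fraction is expanded by n!. In the numerator, orbit counting on each bad class gives
  at most the sum of the automorphism counts; in the denominator, the bound n! on class sizes gives
  at least the number of labeled structures.\<close>

lemma unlabeled_non_generic_ratio_le: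
  assumes n: "n \<ge> 1"
  shows "real (card {C \<in> unlabeled_members n. C \<inter> non_generic k n \<noteq> {}}) / real (card (unlabeled_members n))
    \<le> (\<Sum>d\<in>non_generic k n. real (card (autos {1..n} d))) / real (card (labeled_members n))"
proof -
  define B where "B = {C \<in> unlabeled_members n. C \<inter> non_generic k n \<noteq> {}}"
  define S where "S = (\<Sum>d\<in>non_generic k n. card (autos {1..n} d))"
  have finN: "finite (non_generic k n)"
    unfolding non_generic_def using finite_labeled_members[OF n] by simp
  have "fact n * card B = (\<Sum>C\<in>B. fact n)" by simp
  also have "\<dots> \<le> (\<Sum>C\<in>B. \<Sum>e\<in>C. card (autos {1..n} e))"
    by (rule sum_mono, rule fact_le_sum_card_autos) (simp add: B_def)
  also have "\<dots> = (\<Sum>e\<in>\<Union>B. card (autos {1..n} e))"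
  proof -
    have "\<forall>C\<in>B. finite C" using card_isometry_class_le(1) by (auto simp: B_def)
    moreover have "\<forall>C\<in>B. \<forall>C'\<in>B. C \<noteq> C' \<longrightarrow> C \<inter> C' = {}"
      using quotient_disj[OF equiv_isometry_rel, of _ n] unfolding B_def unlabeled_members_def by blast
    ultimately show ?thesis by (simp add: sum.Union_disjoint)
  qed
  also have "\<dots> \<le> S" unfolding S_def
  proof (rule sum_mono2[OF finN])
    show "\<Union>B \<subseteq> non_generic k n" using non_generic_class unfolding B_def by blast
  qed simp
  finally have 1: "real (fact n * card B) \<le> real S" by (simp only: of_nat_le_iff)
  have 2: "real (card (labeled_members n)) \<le> real (fact n * card (unlabeled_members n))"
    using card_labeled_members_le[OF n] by (simp only: of_nat_le_iff)
  have L: "0 < real (card (labeled_members n))" using card_labeled_members_pos[OF n] by simp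
  have "real (card B) / real (card (unlabeled_members n))
      = real (fact n * card B) / real (fact n * card (unlabeled_members n))" by simp
  also have "\<dots> \<le> real S / real (card (labeled_members n))"
    by (rule frac_le) (use 1 2 L in auto)
  finally show ?thesis by (simp add: B_def S_def)
qed

lemma labeled_non_generic_ratio_le:
  assumes n: "n \<ge> 1"
  shows "real (card (non_generic k n)) / real (card (labeled_members n))
    \<le> (\<Sum>d\<in>non_generic k n. real (card (autos {1..n} d))) / real (card (labeled_members n))"
proof -
  have "1 \<le> real (card (autos {1..n} d))" for d :: "nat \<Rightarrow> nat \<Rightarrow> real"
  proof -
    have "finite (autos {1..n} d)"
      by (rule finite_subset[of _ "{\<sigma>. \<sigma> permutes {1..n}}"]) (auto simp: autos_def finite_permutations)
    moreover have "id \<in> autos {1..n} d" by (simp add: autos_def permutes_id)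
    ultimately have "card (autos {1..n} d) \<noteq> 0" by auto
    then show ?thesis by linarith
  qed
  then have "real (card (non_generic k n)) * 1 \<le> (\<Sum>d\<in>non_generic k n. real (card (autos {1..n} d)))"
    by (rule sum_bounded_below)
  then show ?thesis by (simp add: divide_right_mono)
qed

section \<open>Passage to the limit\<close>

text \<open>Common to both laws: outside the exceptional set \<open>B n\<close> the property has the
  constant truth value \<open>b\<close>, so its proportion differs from 0 or 1 by at most the share
  of \<open>B n\<close>.\<close>

lemma tendsto_proportion:
  fixes S :: "nat \<Rightarrow> 'c set"
  assumes fin: "\<And>n. n \<ge> 1 \<Longrightarrow> finite (S n)" and ne: "\<And>n. n \<ge> 1 \<Longrightarrow> S n \<noteq> {}"
    and bad: "\<And>n x. n \<ge> 1 \<Longrightarrow> x \<in> S n \<Longrightarrow> P n x \<noteq> b \<Longrightarrow> x \<in> B n"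
    and B: "\<And>n. n \<ge> 1 \<Longrightarrow> B n \<subseteq> S n"
    and le: "\<And>n. n \<ge> 1 \<Longrightarrow> real (card (B n)) / real (card (S n)) \<le> r n" and r: "r \<longlonglongrightarrow> 0"
  shows "(\<lambda>n. real (card {x \<in> S n. P n x}) / real (card (S n))) \<longlonglongrightarrow> (if b then 1 else 0)"
proof (rule LIM_zero_cancel, rule Lim_null_comparison[OF _ r], rule eventually_sequentiallyI)
  fix n :: nat assume n: "1 \<le> n"
  have S: "real (card (S n)) > 0" using fin[OF n] ne[OF n] by (simp add: card_gt_0_iff)
  have finB: "finite (B n)" using B[OF n] fin[OF n] finite_subset by blast
  have "\<bar>real (card {x \<in> S n. P n x}) / real (card (S n)) - (if b then 1 else 0)\<bar>
      \<le> real (card (B n)) / real (card (S n))"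
  proof (cases b)
    case True
    have "card (S n) \<le> card ({x \<in> S n. P n x} \<union> B n)"
      by (rule card_mono) (use bad[OF n] True fin[OF n] finB in auto)
    also have "\<dots> \<le> card {x \<in> S n. P n x} + card (B n)" by (rule card_Un_le)
    finally have "real (card (S n)) \<le> real (card {x \<in> S n. P n x}) + real (card (B n))" by linarith
    then have "1 \<le> real (card {x \<in> S n. P n x}) / real (card (S n)) + real (card (B n)) / real (card (S n))"
      using S by (simp add: le_divide_eq flip: add_divide_distrib)
    moreover have "real (card {x \<in> S n. P n x}) / real (card (S n)) \<le> 1"
      using fin[OF n] S by (simp add: divide_le_eq card_mono)
    ultimately show ?thesis using True by (simp add: abs_if)
  next
    case False
    have "card {x \<in> S n. P n x} \<le> card (B n)"
      by (rule card_mono[OF finB]) (use bad[OF n] False in auto)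
    then show ?thesis using False by (simp add: divide_right_mono)
  qed
  then show "norm (real (card {x \<in> S n. P n x}) / real (card (S n)) - (if b then 1 else 0)) \<le> r n"
    using le[OF n] by simp
qed

lemma proportions_tendsto:
  fixes G :: "'a set"
  assumes G: "fraisse_limit G e" and p: "sentence p"
  shows "labeled_proportion p \<longlonglongrightarrow> (if models G e p then 1 else 0)"
    and "unlabeled_proportion p \<longlonglongrightarrow> (if models G e p then 1 else 0)"
proof -
  define k where "k = card (vars p)"
  let ?r = "\<lambda>n. (\<Sum>d\<in>non_generic k n. real (card (autos {1..n} d))) / real (card (labeled_members n))"
  have agree: "models {1..n} d p \<longleftrightarrow> models G e p" if "d \<in> labeled_members n" "d \<notin> non_generic k n" for n d
    using models_iff_one_point_ext[OF _ _ fraisse_limit_imp_bipartite_space[OF G]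
        fraisse_limit_imp_one_point_ext[OF G] p, of "{1..n}" d k] that
    by (simp add: non_generic_def labeled_members_iff k_def)
  have ne: "labeled_members n \<noteq> {}" if "n \<ge> 1" for n using card_labeled_members_pos[OF that] by auto
  have "(\<lambda>n. real (card {d \<in> labeled_members n. models {1..n} d p}) / real (card (labeled_members n)))
      \<longlonglongrightarrow> (if models G e p then 1 else 0)"
    by (rule tendsto_proportion[OF finite_labeled_members ne _ _ labeled_non_generic_ratio_le
          tendsto_autos_non_generic[of k]])
      (use agree in \<open>auto simp: non_generic_def\<close>)
  then show "labeled_proportion p \<longlonglongrightarrow> (if models G e p then 1 else 0)"
    unfolding labeled_proportion_def .
  \<comment> \<open>Nonemptiness matters when the limit refutes \<open>p\<close>: on an empty class
    the universal condition would hold vacuously.\<close>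
  have classD: "C \<subseteq> labeled_members n" "C \<noteq> {}" if "C \<in> unlabeled_members n" for C n
    using in_quotient_imp_subset[OF equiv_isometry_rel] in_quotient_imp_non_empty[OF equiv_isometry_rel] that
    unfolding unlabeled_members_def by blast+
  have "(\<lambda>n. real (card {C \<in> unlabeled_members n. \<forall>d\<in>C. models {1..n} d p}) / real (card (unlabeled_members n)))
      \<longlonglongrightarrow> (if models G e p then 1 else 0)"
  proof (rule tendsto_proportion[OF finite_unlabeled_members _ _ _ unlabeled_non_generic_ratio_le
          tendsto_autos_non_generic[of k]])
    show "unlabeled_members n \<noteq> {}" if "n \<ge> 1" for n
      using ne[OF that] by (simp add: unlabeled_members_def)
    show "C \<in> {C \<in> unlabeled_members n. C \<inter> non_generic k n \<noteq> {}}"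
      if "C \<in> unlabeled_members n" "(\<forall>d\<in>C. models {1..n} d p) \<noteq> models G e p" for C n
      using classD[OF that(1)] that agree by blast
  qed auto
  then show "unlabeled_proportion p \<longlonglongrightarrow> (if models G e p then 1 else 0)"
    unfolding unlabeled_proportion_def .
qed

lemma almost_sure_theory_eq_theory_of:
  assumes "\<And>p. sentence p \<Longrightarrow> m p \<longlonglongrightarrow> (if models G e p then 1 else 0)"
  shows "almost_sure_theory m = theory_of G e"
proof -
  have "m p \<longlonglongrightarrow> 1 \<longleftrightarrow> models G e p" if "sentence p" for p
    using assms[OF that] LIMSEQ_unique[of "m p" 1 0] by (auto split: if_splits)
  then show ?thesis unfolding almost_sure_theory_def theory_of_def by blast
qed

theorem theorem4:
  shows "zero_one_law unlabeled_proportion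
    \<and> zero_one_law labeled_proportion
    \<and> (\<exists>(G :: nat set) d. fraisse_limit G d)
    \<and> (\<forall>(G :: 'a set) d. fraisse_limit G d \<longrightarrow>
          almost_sure_theory unlabeled_proportion = theory_of G d
        \<and> almost_sure_theory labeled_proportion = theory_of G d)"
proof (intro conjI allI impI)
  \<comment> \<open>The explicit limit \<open>ack_dist\<close> decides, for each sentence, which of
    0 and 1 is the limit.\<close>
  show "zero_one_law unlabeled_proportion" "zero_one_law labeled_proportion"
    unfolding zero_one_law_def using proportions_tendsto[OF fraisse_limit_ack_dist]
    by (metis insertI1 insertI2 singletonI)+
  show "\<exists>(G :: nat set) d. fraisse_limit G d" using fraisse_limit_ack_dist by blast
  show "almost_sure_theory unlabeled_proportion = theory_of G d"
    "almost_sure_theory labeled_proportion = theory_of G d" if "fraisse_limit G d" for G :: "'a set" and d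
    using almost_sure_theory_eq_theory_of proportions_tendsto[OF that] by metis+
qed

end
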